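(* If $\emptyset \vdash P \triangleright \emptyset$ (i.e., $P$ is a well-typed APCP process under empty recursion and name contexts), then either $P \equiv \mathbf{0}$ or $P \longrightarrow Q$ for some process $Q$.
   Context: APCP is an asynchronous session-typed $\pi$-calculus with processes $P,Q ::= \overline{x}[a,b]$ (send) $\mid x(y,z);P$ (receive) $\mid \overline{x}[b] \triangleleft \ell$ (selection) $\mid x(z) \triangleright \{i : P_i\}_{i\in I}$ (branch) $\mid (\nu xy)P$ (restriction connecting dual names) $\mid P \mid Q$ $\mid \mathbf{0}$ $\mid x \leftrightarrow y$ (forwarder) $\mid \mu X(\tilde z);P$ (contractive tail-recursive definition) $\mid X\langle \tilde z\rangle$. Structural congruence $\equiv$ is standard (incl. $(\nu xy)\mathbf 0\equiv\mathbf 0$, $(\nu xy)(x\leftrightarrow y)\equiv\mathbf 0$, unfolding of recursion). Reduction: $(\nu xy)(\overline{x}[a,b] \mid y(z,y');Q) \longrightarrow Q\{a/z,b/y'\}$; $(\nu xy)(\overline{x}[b]\triangleleft j \mid y(y')\triangleright\{i:Q_i\}_{i\in I}) \longrightarrow Q_j\{b/y'\}$ ($j\in I$); $(\nu xy)(x\leftrightarrow z \mid P)\longrightarrow P\{z/y\}$ ($y\ne z$); closed under $\equiv$, restriction, parallel. Types $A ::= A\otimes^{o}B \mid A⅋^{o}B \mid \oplus^{o}\{i:A_i\} \mid \&^{o}\{i:A_i\} \mid \bullet \mid \mu X.A \mid X$ carry priorities $o\in\mathbb N$; $\mathrm{pr}(A)$ is the outermost priority ($\omega$ for $\bullet$,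 $X$). Judgments $\Omega\vdash P\triangleright\Gamma$ (linear $\Gamma$); the rules require: sends/selections with priority $o$ have payload and continuation types with priority $>o$; receives/branches with priority $o$ have all other names of the continuation with priority $>o$; restricted names have dual types (hence equal priorities); recursion unfolds types lifting all priorities by a common $t$ greater than the top priority of the types. *)

theory Defs
  imports "HOL-Library.Finite_Map" "HOL-Library.Extended_Nat"
begin

(* Names, recursion variables and type variables are de Bruijn indices, so that terms are
   processes and types up to alpha-equivalence. The three kinds of index are independent. *)

type_synonym name = nat
type_synonym label = string


section \<open>Processes\<close>

(* Name binders:
     Recv x P    is  x(y,z);P         with y = 0, z = 1 in P, ambient names shifted by 2;
     Bra x Ps    is  x(z) |> {i:P_i}  with z = 0 in each P_i, ambient names shifted by 1;
     Res P       is  (nu x y)P        with x = 0, y = 1 in P, ambient names shifted by 2.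
   Rec zs P is mu X(zs);P. It binds the recursion variable 0 in P but no names: the list zs
   consists of the free names of the loop. *)

datatype proc =
    Send name name name
  | Recv name proc
  | Sel name name label
  | Bra name "(label, proc) fmap"
  | Res proc
  | Par proc proc
  | Inact
  | Fwd name name
  | Rec "name list" proc
  | Call nat "name list"

definition up :: "(nat \<Rightarrow> nat) \<Rightarrow> nat \<Rightarrow> nat" where
  "up f = case_nat 0 (\<lambda>n. Suc (f n))"

abbreviation shift2 :: "nat \<Rightarrow> nat" where
  "shift2 n \<equiv> n + 2"

(* Capture-avoiding simultaneous renaming of free names. *)
primrec ren :: "(name \<Rightarrow> name) \<Rightarrow> proc \<Rightarrow> proc" where
  "ren f (Send x a b) = Send (f x) (f a) (f b)"
| "ren f (Recv x P) = Recv (f x) (ren (up (up f)) P)"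
| "ren f (Sel x b l) = Sel (f x) (f b) l"
| "ren f (Bra x Ps) = Bra (f x) (fmmap (ren (up f)) Ps)"
| "ren f (Res P) = Res (ren (up (up f)) P)"
| "ren f (Par P Q) = Par (ren f P) (ren f Q)"
| "ren f Inact = Inact"
| "ren f (Fwd x y) = Fwd (f x) (f y)"
| "ren f (Rec zs P) = Rec (map f zs) (ren f P)"
| "ren f (Call X zs) = Call X (map f zs)"

(* Renaming of free recursion variables. *)
primrec pren :: "(nat \<Rightarrow> nat) \<Rightarrow> proc \<Rightarrow> proc" where
  "pren f (Send x a b) = Send x a b"
| "pren f (Recv x P) = Recv x (pren f P)"
| "pren f (Sel x b l) = Sel x b l"
| "pren f (Bra x Ps) = Bra x (fmmap (pren f) Ps)"
| "pren f (Res P) = Res (pren f P)"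
| "pren f (Par P Q) = Par (pren f P) (pren f Q)"
| "pren f Inact = Inact"
| "pren f (Fwd x y) = Fwd x y"
| "pren f (Rec zs P) = Rec zs (pren (up f) P)"
| "pren f (Call X zs) = Call (f X) zs"

definition replace :: "name list \<Rightarrow> name list \<Rightarrow> name \<Rightarrow> name" where
  "replace zs ys n = (case map_of (zip zs ys) n of Some y \<Rightarrow> y | None \<Rightarrow> n)"

(* psub k zs B P is P{(mu X(ys);B{ys/zs}) / X<ys>}, where X is the recursion variable k of P;
   k is removed from the free recursion variables of P. The loop (zs, B) is shifted
   whenever a binder of P is crossed; in B, the recursion variable 0 is the loop itself. *)
primrec psub :: "nat \<Rightarrow> name list \<Rightarrow> proc \<Rightarrow> proc \<Rightarrow> proc" where
  "psub k zs B (Send x a b) = Send x a b"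
| "psub k zs B (Recv x P) = Recv x (psub k (map shift2 zs) (ren shift2 B) P)"
| "psub k zs B (Sel x b l) = Sel x b l"
| "psub k zs B (Bra x Ps) = Bra x (fmmap (psub k (map Suc zs) (ren Suc B)) Ps)"
| "psub k zs B (Res P) = Res (psub k (map shift2 zs) (ren shift2 B) P)"
| "psub k zs B (Par P Q) = Par (psub k zs B P) (psub k zs B Q)"
| "psub k zs B Inact = Inact"
| "psub k zs B (Fwd x y) = Fwd x y"
| "psub k zs B (Rec ws P) = Rec ws (psub (Suc k) zs (pren (up Suc) B) P)"
| "psub k zs B (Call X ys) =
     (if X = k then Rec ys (ren (replace zs ys) B)
      else Call (if k < X then X - 1 else X) ys)"


subsection \<open>Contractive recursion\<close>

(* Some communication action of P occurs outside all receives and branches. *)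
primrec exposes_action :: "proc \<Rightarrow> bool" where
  "exposes_action (Send x a b) = True"
| "exposes_action (Recv x P) = True"
| "exposes_action (Sel x b l) = True"
| "exposes_action (Bra x Ps) = True"
| "exposes_action (Res P) = exposes_action P"
| "exposes_action (Par P Q) = (exposes_action P \<or> exposes_action Q)"
| "exposes_action Inact = False"
| "exposes_action (Fwd x y) = False"
| "exposes_action (Rec zs P) = exposes_action P"
| "exposes_action (Call X zs) = False"

(* Some call to the recursion variable k occurs in P outside all receives and branches. *)
primrec exposes_call :: "nat \<Rightarrow> proc \<Rightarrow> bool" where
  "exposes_call k (Send x a b) = False"
| "exposes_call k (Recv x P) = False"
| "exposes_call k (Sel x b l) = False"
| "exposes_call k (Bra x Ps) = False"
| "exposes_call k (Res P) = exposes_call k P"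
| "exposes_call k (Par P Q) = (exposes_call k P \<or> exposes_call k Q)"
| "exposes_call k Inact = False"
| "exposes_call k (Fwd x y) = False"
| "exposes_call k (Rec zs P) = exposes_call (Suc k) P"
| "exposes_call k (Call X zs) = (X = k)"

(* Every unfolding of a loop that reaches a new call exposes an action. Guarding all calls by
   receives or branches is sufficient, but not necessary: sends and selections have no
   continuation, so a loop that outputs on x and then continues is written with the output in
   parallel with the call, mu X(x);(nu a b)(x[c,a] | X<b>), and is contractive too.
   Loops such as mu X();(X<> | 0) are not contractive.
   Recursion is tail recursion by the grammar, as calls have no continuation. *)
primrec contractive :: "proc \<Rightarrow> bool" where
  "contractive (Send x a b) = True"
| "contractive (Recv x P) = contractive P"
| "contractive (Sel x b l) = True"
| "contractive (Bra x Ps) = fBall (fmran (fmmap contractive Ps)) (\<lambda>c. c)"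
| "contractive (Res P) = contractive P"
| "contractive (Par P Q) = (contractive P \<and> contractive Q)"
| "contractive Inact = True"
| "contractive (Fwd x y) = True"
| "contractive (Rec zs P) = (contractive P \<and> (exposes_call 0 P \<longrightarrow> exposes_action P))"
| "contractive (Call X zs) = True"


subsection \<open>Structural congruence and reduction\<close>

(* Renames P under (nu x y)(nu z w) to P under (nu z w)(nu x y). *)
definition swap_res :: "name \<Rightarrow> name" where
  "swap_res n = (if n < 2 then n + 2 else if n < 4 then n - 2 else n)"

definition swap_ends :: "name \<Rightarrow> name" where
  "swap_ends n = (if n = 0 then 1 else if n = 1 then 0 else n)"

inductive scong :: "proc \<Rightarrow> proc \<Rightarrow> bool" (infix \<open>\<equiv>\<^sub>s\<close> 50) where
  sc_refl: "P \<equiv>\<^sub>s P"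
| sc_sym: "P \<equiv>\<^sub>s Q \<Longrightarrow> Q \<equiv>\<^sub>s P"
| sc_trans: "P \<equiv>\<^sub>s Q \<Longrightarrow> Q \<equiv>\<^sub>s R \<Longrightarrow> P \<equiv>\<^sub>s R"
| sc_cong_recv: "P \<equiv>\<^sub>s Q \<Longrightarrow> Recv x P \<equiv>\<^sub>s Recv x Q"
| sc_cong_bra: "P \<equiv>\<^sub>s Q \<Longrightarrow> Bra x (fmupd l P Ps) \<equiv>\<^sub>s Bra x (fmupd l Q Ps)"
| sc_cong_res: "P \<equiv>\<^sub>s Q \<Longrightarrow> Res P \<equiv>\<^sub>s Res Q"
| sc_cong_par: "P \<equiv>\<^sub>s Q \<Longrightarrow> Par P R \<equiv>\<^sub>s Par Q R"
| sc_cong_rec: "P \<equiv>\<^sub>s Q \<Longrightarrow> Rec zs P \<equiv>\<^sub>s Rec zs Q"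
| sc_par_comm: "Par P Q \<equiv>\<^sub>s Par Q P"
| sc_par_assoc: "Par P (Par Q R) \<equiv>\<^sub>s Par (Par P Q) R"
| sc_par_inact: "Par P Inact \<equiv>\<^sub>s P"
| sc_fwd_sym: "Fwd x y \<equiv>\<^sub>s Fwd y x"
| sc_res_fwd: "Res (Fwd 0 1) \<equiv>\<^sub>s Inact"
| sc_res_inact: "Res Inact \<equiv>\<^sub>s Inact"
| sc_res_sym: "Res P \<equiv>\<^sub>s Res (ren swap_ends P)"
| sc_res_comm: "Res (Res P) \<equiv>\<^sub>s Res (Res (ren swap_res P))"
| sc_res_par: "Par P (Res Q) \<equiv>\<^sub>s Res (Par (ren shift2 P) Q)"
| sc_unfold: "Rec zs P \<equiv>\<^sub>s psub 0 zs P P"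

(* Reducts leave the scope of the restriction (nu x y). The shifts on the left-hand sides say
   that x and y occur nowhere but at the positions of the redex (y also in P, in red_fwd, where
   it becomes the index 0 of P). *)
inductive red :: "proc \<Rightarrow> proc \<Rightarrow> bool" (infix \<open>\<longmapsto>\<close> 50) where
  red_comm:
    "Res (Par (Send 0 (a + 2) (b + 2)) (Recv 1 (ren (up (up shift2)) Q)))
       \<longmapsto> ren (case_nat a (case_nat b id)) Q"
| red_choice:
    "fmlookup Qs j = Some Q \<Longrightarrow>
     Res (Par (Sel 0 (b + 2) j) (Bra 1 (fmmap (ren (up shift2)) Qs)))
       \<longmapsto> ren (case_nat b id) Q"
| red_fwd:
    "Res (Par (Fwd 0 (z + 2)) (ren Suc P)) \<longmapsto> ren (case_nat z id) P"
| red_scong: "P \<equiv>\<^sub>s P' \<Longrightarrow> P' \<longmapsto> Q' \<Longrightarrow> Q' \<equiv>\<^sub>s Q \<Longrightarrow> P \<longmapsto> Q"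
| red_res: "P \<longmapsto> Q \<Longrightarrow> Res P \<longmapsto> Res Q"
| red_par: "P \<longmapsto> Q \<Longrightarrow> Par P R \<longmapsto> Par Q R"


section \<open>Session types\<close>

(* Mu A binds the type variable 0 in A. *)
datatype type =
    Tensor nat type type
  | Parr nat type type
  | Plus nat "(label, type) fmap"
  | With nat "(label, type) fmap"
  | Done
  | Mu type
  | TVar nat

primrec dual :: "type \<Rightarrow> type" where
  "dual (Tensor p A B) = Parr p (dual A) (dual B)"
| "dual (Parr p A B) = Tensor p (dual A) (dual B)"
| "dual (Plus p As) = With p (fmmap dual As)"
| "dual (With p As) = Plus p (fmmap dual As)"
| "dual Done = Done"
| "dual (Mu A) = Mu (dual A)"
| "dual (TVar X) = TVar X"

primrec pr :: "type \<Rightarrow> enat" where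
  "pr (Tensor p A B) = enat p"
| "pr (Parr p A B) = enat p"
| "pr (Plus p As) = enat p"
| "pr (With p As) = enat p"
| "pr Done = \<infinity>"
| "pr (Mu A) = pr A"
| "pr (TVar X) = \<infinity>"

primrec max_pr :: "type \<Rightarrow> nat" where
  "max_pr (Tensor p A B) = max p (max (max_pr A) (max_pr B))"
| "max_pr (Parr p A B) = max p (max (max_pr A) (max_pr B))"
| "max_pr (Plus p As) = Max (fset (finsert p (fmran (fmmap max_pr As))))"
| "max_pr (With p As) = Max (fset (finsert p (fmran (fmmap max_pr As))))"
| "max_pr Done = 0"
| "max_pr (Mu A) = max_pr A"
| "max_pr (TVar X) = 0"

primrec lift :: "nat \<Rightarrow> type \<Rightarrow> type" where
  "lift t (Tensor p A B) = Tensor (p + t) (lift t A) (lift t B)"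
| "lift t (Parr p A B) = Parr (p + t) (lift t A) (lift t B)"
| "lift t (Plus p As) = Plus (p + t) (fmmap (lift t) As)"
| "lift t (With p As) = With (p + t) (fmmap (lift t) As)"
| "lift t Done = Done"
| "lift t (Mu A) = Mu (lift t A)"
| "lift t (TVar X) = TVar X"

primrec tren :: "(nat \<Rightarrow> nat) \<Rightarrow> type \<Rightarrow> type" where
  "tren f (Tensor p A B) = Tensor p (tren f A) (tren f B)"
| "tren f (Parr p A B) = Parr p (tren f A) (tren f B)"
| "tren f (Plus p As) = Plus p (fmmap (tren f) As)"
| "tren f (With p As) = With p (fmmap (tren f) As)"
| "tren f Done = Done"
| "tren f (Mu A) = Mu (tren (up f) A)"
| "tren f (TVar X) = TVar (f X)"

primrec tsub :: "(nat \<Rightarrow> type) \<Rightarrow> type \<Rightarrow> type" where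
  "tsub s (Tensor p A B) = Tensor p (tsub s A) (tsub s B)"
| "tsub s (Parr p A B) = Parr p (tsub s A) (tsub s B)"
| "tsub s (Plus p As) = Plus p (fmmap (tsub s) As)"
| "tsub s (With p As) = With p (fmmap (tsub s) As)"
| "tsub s Done = Done"
| "tsub s (Mu A) = Mu (tsub (case_nat (TVar 0) (\<lambda>n. tren Suc (s n))) A)"
| "tsub s (TVar X) = s X"

(* The unfolding of Mu A (not of A) with lift t: A{mu X.(lift t A) / X}. *)
definition unfold :: "nat \<Rightarrow> type \<Rightarrow> type" where
  "unfold t A = tsub (case_nat (Mu (lift t A)) TVar) A"


section \<open>Typing\<close>

type_synonym ctx = "name \<rightharpoonup> type"

(* The context of the body of a name binder: the bound name 0 has type A. *)
definition bind :: "type \<Rightarrow> ctx \<Rightarrow> ctx" (infixr \<open>\<bullet>\<close> 65) where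
  "A \<bullet> \<Gamma> = case_nat (Some A) \<Gamma>"

definition below :: "nat \<Rightarrow> ctx \<Rightarrow> bool" where
  "below p \<Gamma> \<longleftrightarrow> (\<forall>A \<in> ran \<Gamma>. enat p < pr A)"

(* The X-th entry of the recursion context is the tuple of types assigned to the recursion
   variable X; an entry A stands for the recursive type Mu A. *)
inductive typed :: "type list list \<Rightarrow> proc \<Rightarrow> ctx \<Rightarrow> bool" (\<open>_ \<turnstile> _ \<triangleright> _\<close> [51, 51, 51] 50) where
  typ_send:
    "distinct [x, y, z] \<Longrightarrow> enat p < pr A \<Longrightarrow> enat p < pr B \<Longrightarrow>
     \<Omega> \<turnstile> Send x y z \<triangleright> [x \<mapsto> Tensor p A B, y \<mapsto> dual A, z \<mapsto> dual B]"
| typ_recv: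
    "\<Omega> \<turnstile> P \<triangleright> A \<bullet> B \<bullet> \<Gamma> \<Longrightarrow> x \<notin> dom \<Gamma> \<Longrightarrow> below p \<Gamma> \<Longrightarrow>
     \<Omega> \<turnstile> Recv x P \<triangleright> \<Gamma>(x \<mapsto> Parr p A B)"
| typ_sel:
    "x \<noteq> z \<Longrightarrow> fmlookup As j = Some A \<Longrightarrow> enat p < pr A \<Longrightarrow>
     \<Omega> \<turnstile> Sel x z j \<triangleright> [x \<mapsto> Plus p As, z \<mapsto> dual A]"
| typ_bra:
    "fmdom Ps = fmdom As \<Longrightarrow>
     (\<And>i P A. fmlookup Ps i = Some P \<Longrightarrow> fmlookup As i = Some A \<Longrightarrow> \<Omega> \<turnstile> P \<triangleright> A \<bullet> \<Gamma>) \<Longrightarrow>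
     x \<notin> dom \<Gamma> \<Longrightarrow> below p \<Gamma> \<Longrightarrow>
     \<Omega> \<turnstile> Bra x Ps \<triangleright> \<Gamma>(x \<mapsto> With p As)"
| typ_end: "\<Omega> \<turnstile> P \<triangleright> \<Gamma> \<Longrightarrow> x \<notin> dom \<Gamma> \<Longrightarrow> \<Omega> \<turnstile> P \<triangleright> \<Gamma>(x \<mapsto> Done)"
| typ_inact: "\<Omega> \<turnstile> Inact \<triangleright> Map.empty"
| typ_par:
    "\<Omega> \<turnstile> P \<triangleright> \<Gamma> \<Longrightarrow> \<Omega> \<turnstile> Q \<triangleright> \<Delta> \<Longrightarrow> dom \<Gamma> \<inter> dom \<Delta> = {} \<Longrightarrow> \<Omega> \<turnstile> Par P Q \<triangleright> \<Gamma> ++ \<Delta>"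
| typ_res: "\<Omega> \<turnstile> P \<triangleright> A \<bullet> dual A \<bullet> \<Gamma> \<Longrightarrow> \<Omega> \<turnstile> Res P \<triangleright> \<Gamma>"
| typ_fwd: "x \<noteq> y \<Longrightarrow> \<Omega> \<turnstile> Fwd x y \<triangleright> [x \<mapsto> A, y \<mapsto> dual A]"
| typ_rec:
    "As # \<Omega> \<turnstile> P \<triangleright> map_of (zip zs (map (unfold t) As)) \<Longrightarrow>
     distinct zs \<Longrightarrow> length zs = length As \<Longrightarrow> \<forall>A \<in> set As. max_pr A < t \<Longrightarrow>
     \<Omega> \<turnstile> Rec zs P \<triangleright> map_of (zip zs (map Mu As))"
| typ_call:
    "X < length \<Omega> \<Longrightarrow> \<Omega> ! X = As \<Longrightarrow> distinct zs \<Longrightarrow> length zs = length As \<Longrightarrow>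
     \<Omega> \<turnstile> Call X zs \<triangleright> map_of (zip zs (map (\<lambda>A. Mu (lift t A)) As))"

end

theory Submission
  imports Defs
begin

text \<open>Only the outermost connective, the priority and the number of leading \<open>Mu\<close>s of each type
  matter for progress. These heads are invariant under the unfolding of types, except that each
  unfolding of a loop removes one leading \<open>Mu\<close>; in particular they do not depend on the lift \<open>t\<close>
  that a loop chooses, on which the two loops at the endpoints of a channel need not agree.
  Suppose that a process has an exposed action. Among all processes congruent to it, take an exposed
  action of least priority \<open>p\<close>, say on \<open>x\<close>. The other endpoint of \<open>x\<close> has priority \<open>p\<close> as well.
  Unfold the loops that hold it until it occurs outside all loops. It is not a payload and not under
  a prefix, as it would then have a higher priority than some other exposed subject. Hence it is
  in a forwarder or the subject of a dual action, and both reduce. If no action is exposed,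
  then contractivity rules out all calls, the loops unfold to nothing but forwarders,
  and each forwarder either reduces or connects two dual names and vanishes.\<close>

section \<open>Renaming and free names\<close>

lemma up_simps [simp]: "up f 0 = 0" "up f (Suc n) = Suc (f n)"
  by (auto simp: up_def)

lemma up_up: "up (up f) i = (if i < 2 then i else f (i - 2) + 2)"
proof (cases i)
  case (Suc j)
  then show ?thesis by (cases j) simp_all
qed simp

lemma up_up_image: "i + 2 \<in> up (up f) ` N \<Longrightarrow> i \<in> f ` {i. i + 2 \<in> N}"
proof -
  assume "i + 2 \<in> up (up f) ` N"
  then obtain j where j: "j \<in> N" "i + 2 = up (up f) j" by blast
  then have "\<not> j < 2" by (auto simp: up_up)
  then have "j - 2 + 2 = j" by simp
  with j \<open>\<not> j < 2\<close> show ?thesis by (intro image_eqI[of _ _ "j - 2"]) (simp_all add: up_up)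
qed

lemma up_up_cong:
  assumes "\<And>j. j + 2 \<in> N \<Longrightarrow> f j = g j" "i \<in> N"
  shows "up (up f) i = up (up g) i"
proof (cases "i < 2")
  case False
  then have "i - 2 + 2 = i" by simp
  with assms(1)[of "i - 2"] assms(2) False show ?thesis by (simp add: up_up)
qed (simp add: up_up)

lemma up_comp: "up f \<circ> up g = up (f \<circ> g)"
proof
  show "(up f \<circ> up g) i = up (f \<circ> g) i" for i by (cases i) simp_all
qed

lemma up_id [simp]: "up (\<lambda>i. i) = (\<lambda>i. i)"
proof
  show "up (\<lambda>i. i) i = i" for i by (cases i) simp_all
qed

lemma inj_up: "inj f \<Longrightarrow> inj (up f)"
proof (rule injI)
  fix i j assume "inj f" "up f i = up f j"
  then show "i = j" by (cases i; cases j) (simp_all add: inj_eq)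
qed

primrec fn :: "proc \<Rightarrow> name set" where
  "fn (Send x a b) = {x, a, b}"
| "fn (Recv x P) = insert x {i. i + 2 \<in> fn P}"
| "fn (Sel x b l) = {x, b}"
| "fn (Bra x Ps) = insert x {i. \<exists>N \<in> fset (fmran (fmmap fn Ps)). Suc i \<in> N}"
| "fn (Res P) = {i. i + 2 \<in> fn P}"
| "fn (Par P Q) = fn P \<union> fn Q"
| "fn Inact = {}"
| "fn (Fwd x y) = {x, y}"
| "fn (Rec zs P) = set zs \<union> fn P"
| "fn (Call X zs) = set zs"

lemma ren_cong: "(\<And>i. i \<in> fn P \<Longrightarrow> f i = g i) \<Longrightarrow> ren f P = ren g P"
proof (induction P arbitrary: f g)
  case (Recv x P)
  have "ren (up (up f)) P = ren (up (up g)) P"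
    by (rule Recv.IH, rule up_up_cong[where N = "fn P"]) (use Recv.prems in auto)
  with Recv.prems show ?case by simp
next
  case (Res P)
  have "ren (up (up f)) P = ren (up (up g)) P"
    by (rule Res.IH, rule up_up_cong[where N = "fn P"]) (use Res.prems in auto)
  then show ?case by simp
next
  case (Bra x Ps)
  have "ren (up f) P = ren (up g) P" if "P \<in> fmran' Ps" for P
  proof (rule Bra.IH)
    fix i assume "i \<in> fn P"
    with that Bra.prems show "up f i = up g i"
      by (cases i) (auto simp: fmran'_alt_def)
  qed (use that in \<open>auto simp: fmran'_alt_def\<close>)
  then show ?case using Bra.prems by (auto intro!: fmap.map_cong)
next
  case (Par P Q)
  have "ren f P = ren g P" "ren f Q = ren g Q"
    by (rule Par.IH; use Par.prems in simp)+
  then show ?case by simp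
next
  case (Rec zs P)
  have "ren f P = ren g P" by (rule Rec.IH) (use Rec.prems in auto)
  with Rec.prems show ?case by auto
qed auto

lemma ren_ren: "ren f (ren g P) = ren (f \<circ> g) P"
  by (induction P arbitrary: f g)
    (auto simp: up_comp fmap.map_comp fmran'_alt_def intro!: fmap.map_cong)

lemma ren_id [simp]: "ren id P = P"
  by (induction P) (auto simp: id_def fmran'_alt_def intro!: fmap.map_ident_strong)

lemma fn_ren: "fn (ren f P) \<subseteq> f ` fn P"
proof (induction P arbitrary: f)
  case (Recv x P)
  have "i \<in> f ` {i. i + 2 \<in> fn P}" if "i + 2 \<in> fn (ren (up (up f)) P)" for i
    using subsetD[OF Recv.IH that] up_up_image by blast
  then show ?case by auto
next
  case (Res P)
  have "i \<in> f ` {i. i + 2 \<in> fn P}" if "i + 2 \<in> fn (ren (up (up f)) P)" for i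
    using subsetD[OF Res.IH that] up_up_image by blast
  then show ?case by auto
next
  case (Bra x Ps)
  have "i \<in> f ` fn (Bra x Ps)" if "P \<in> fset (fmran Ps)" "Suc i \<in> fn (ren (up f) P)" for i P
  proof -
    have "Suc i \<in> up f ` fn P" using Bra.IH[of P "up f"] that by (auto simp: fmran'_alt_def)
    then obtain j where "j \<in> fn P" "Suc i = up f j" by auto
    then show ?thesis using that by (cases j) auto
  qed
  then show ?case by (auto simp: fmap.map_comp)
next
  case (Par P Q)
  then show ?case by (metis Un_mono image_Un fn.simps(6) ren.simps(6))
qed auto

text \<open>Head typing below stops at prefixes, but unfolding also substitutes under them. This
  invariant controls those parts: loop bodies have no free names besides the listed ones, and calls
  match the arities in \<open>ar\<close>, innermost loop first. With \<open>ar = []\<close>, no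
  recursion variable is free.\<close>

primrec wf_rec :: "proc \<Rightarrow> nat list \<Rightarrow> bool" where
  "wf_rec (Send x a b) ar = True"
| "wf_rec (Recv x P) ar = wf_rec P ar"
| "wf_rec (Sel x b l) ar = True"
| "wf_rec (Bra x Ps) ar = (\<forall>p \<in> fset (fmran (fmmap wf_rec Ps)). p ar)"
| "wf_rec (Res P) ar = wf_rec P ar"
| "wf_rec (Par P Q) ar = (wf_rec P ar \<and> wf_rec Q ar)"
| "wf_rec Inact ar = True"
| "wf_rec (Fwd x y) ar = True"
| "wf_rec (Rec zs P) ar = (fn P \<subseteq> set zs \<and> wf_rec P (length zs # ar))"
| "wf_rec (Call X zs) ar = (X < length ar \<and> length zs = ar ! X)"

lemma wf_rec_ren: "wf_rec P ar \<Longrightarrow> wf_rec (ren f P) ar"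
proof (induction P arbitrary: f ar)
  case (Rec zs P)
  then have "f ` fn P \<subseteq> f ` set zs" by auto
  with Rec show ?case using fn_ren[of f P] by auto
qed (auto simp: fmran'_alt_def)

lemma wf_rec_append: "wf_rec P ar \<Longrightarrow> wf_rec P (ar @ ar')"
proof (induction P arbitrary: ar)
  case (Rec zs P)
  then show ?case using Rec.IH[of "length zs # ar"] by simp
qed (auto simp: fmran'_alt_def nth_append)

text \<open>Used for the shift \<open>pren (up Suc) B\<close> in \<open>psub\<close>: the body of a
  closed loop has only the recursion variable 0 free, and \<open>up Suc\<close> fixes it.\<close>

lemma pren_wf_rec: "wf_rec P ar \<Longrightarrow> (\<And>i. i < length ar \<Longrightarrow> f i = i) \<Longrightarrow> pren f P = P"
proof (induction P arbitrary: f ar)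
  case (Rec zs P)
  have "pren (up f) P = P"
  proof (rule Rec.IH)
    show "wf_rec P (length zs # ar)" using Rec.prems by simp
    show "up f i = i" if "i < length (length zs # ar)" for i
      using that Rec.prems by (cases i) auto
  qed
  then show ?case by simp
next
  case (Bra x Ps)
  have "pren f P = P" if "P \<in> fmran' Ps" for P
    by (rule Bra.IH[where ar=ar]) (use that Bra.prems in \<open>auto simp: fmran'_alt_def\<close>)
  then show ?case by (auto intro!: fmap.map_ident_strong)
qed auto

lemma map_replace: "distinct zs \<Longrightarrow> length zs = length ys \<Longrightarrow> map (replace zs ys) zs = ys"
  by (rule nth_equalityI) (auto simp: replace_def map_of_zip_nth)

lemma replace_in: "length zs = length ys \<Longrightarrow> i \<in> set zs \<Longrightarrow> replace zs ys i \<in> set ys"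
  unfolding replace_def
  by (auto split: option.splits dest!: map_of_SomeD set_zip_rightD simp: map_of_zip_is_None)

text \<open>The substituted variable is the outermost one, so its index is \<open>length ar\<close>
  and its arity comes last. Free names cannot grow, because a call
  \<open>X\<langle>ys\<rangle>\<close> is replaced by a loop body whose listed names have all become
  elements of \<open>ys\<close>.\<close>

lemma psub_wf_rec:
  assumes "wf_rec P (ar @ [length zs])" "wf_rec (Rec zs B) []"
  shows "fn (psub (length ar) zs B P) \<subseteq> fn P \<and> wf_rec (psub (length ar) zs B P) ar"
  using assms
proof (induction P arbitrary: ar zs B)
  case (Recv x P)
  have "wf_rec (ren shift2 (Rec zs B)) []" using Recv.prems(2) by (rule wf_rec_ren)
  then have "fn (psub (length ar) (map shift2 zs) (ren shift2 B) P) \<subseteq> fn P \<and>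
      wf_rec (psub (length ar) (map shift2 zs) (ren shift2 B) P) ar"
    using Recv.prems(1) by (intro Recv.IH) auto
  then show ?case by auto
next
  case (Res P)
  have "wf_rec (ren shift2 (Rec zs B)) []" using Res.prems(2) by (rule wf_rec_ren)
  then have "fn (psub (length ar) (map shift2 zs) (ren shift2 B) P) \<subseteq> fn P \<and>
      wf_rec (psub (length ar) (map shift2 zs) (ren shift2 B) P) ar"
    using Res.prems(1) by (intro Res.IH) auto
  then show ?case by auto
next
  case (Bra x Ps)
  have "wf_rec (ren Suc (Rec zs B)) []" using Bra.prems(2) by (rule wf_rec_ren)
  then have "fn (psub (length ar) (map Suc zs) (ren Suc B) P) \<subseteq> fn P \<and>
      wf_rec (psub (length ar) (map Suc zs) (ren Suc B) P) ar" if "P |\<in>| fmran Ps" for P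
    using that Bra.prems(1) by (intro Bra.IH) (auto simp: fmran'_alt_def)
  then show ?case by (auto simp: fmap.map_comp)
next
  case (Par P Q)
  then have "wf_rec P (ar @ [length zs])" "wf_rec Q (ar @ [length zs])" by simp_all
  with Par.IH[OF _ Par.prems(2)] show ?case by (auto dest!: subsetD)
next
  case (Rec ws P)
  have "pren (up Suc) B = B"
    using Rec.prems(2) by (intro pren_wf_rec[of _ "[length zs]"]) auto
  then show ?case using Rec.IH[of "length ws # ar" zs B] Rec.prems by auto
next
  case (Call X ys)
  show ?case
  proof (cases "X = length ar")
    case True
    then have len: "length zs = length ys" using Call.prems by simp
    have sub: "fn (ren (replace zs ys) B) \<subseteq> set ys"
      using fn_ren[of "replace zs ys" B] Call.prems(2) replace_in[OF len] by auto
    moreover have "wf_rec B ([length ys] @ ar)"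
      by (rule wf_rec_append) (use Call.prems(2) len in auto)
    ultimately show ?thesis using True by (auto intro!: wf_rec_ren)
  next
    case False
    then show ?thesis using Call.prems by (auto simp: nth_append)
  qed
qed auto

section \<open>Head typing\<close>

text \<open>Label sets are kept so that duality of heads alone ensures that a selected label has a
  branch.\<close>

datatype kind = KTensor | KParr | KPlus "label fset" | KWith "label fset"

primrec dual_kind :: "kind \<Rightarrow> kind" where
  "dual_kind KTensor = KParr"
| "dual_kind KParr = KTensor"
| "dual_kind (KPlus L) = KWith L"
| "dual_kind (KWith L) = KPlus L"

text \<open>The head \<open>Some (k, p, c)\<close> is that of \<open>c\<close> nested recursive types around a connective
  \<open>k\<close> with priority \<open>p\<close>; \<open>None\<close> is the head of a type without outermost connective.\<close>

type_synonym hd = "(kind \<times> nat \<times> nat) option"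

primrec head :: "type \<Rightarrow> hd" where
  "head (Tensor p A B) = Some (KTensor, p, 0)"
| "head (Parr p A B) = Some (KParr, p, 0)"
| "head (Plus p As) = Some (KPlus (fmdom As), p, 0)"
| "head (With p As) = Some (KWith (fmdom As), p, 0)"
| "head Done = None"
| "head (Mu A) = map_option (\<lambda>(k, p, c). (k, p, Suc c)) (head A)"
| "head (TVar X) = None"

definition head_lift :: "nat \<Rightarrow> hd \<Rightarrow> hd" where
  "head_lift t = map_option (\<lambda>(k, p, c). (k, p + t, c))"

definition head_unfold :: "hd \<Rightarrow> hd" where
  "head_unfold = map_option (\<lambda>(k, p, c). (k, p, c - 1))"

definition above :: "nat \<Rightarrow> hd \<Rightarrow> bool" where
  "above p h \<longleftrightarrow> (\<forall>k q c. h = Some (k, q, c) \<longrightarrow> p < q)"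

definition unfoldable :: "hd \<Rightarrow> bool" where
  "unfoldable h \<longleftrightarrow> (\<forall>k p c. h = Some (k, p, c) \<longrightarrow> 0 < c)"

text \<open>The numbers of leading \<open>Mu\<close>s are not compared: the two loops that hold the endpoints of
  a channel are unfolded independently of each other.\<close>

definition compat :: "hd \<Rightarrow> hd \<Rightarrow> bool" where
  "compat h h' \<longleftrightarrow>
     map_option (\<lambda>(k, p, c). (dual_kind k, p)) h = map_option (\<lambda>(k, p, c). (k, p)) h'"

lemma dual_kind_dual [simp]: "dual_kind (dual_kind k) = k"
  by (cases k) auto

lemma compat_sym: "compat h h' \<Longrightarrow> compat h' h"
  by (auto simp: compat_def map_option_case split: option.splits)

lemma compat_Some: "compat (Some (k, p, c)) h \<longleftrightarrow> (\<exists>c'. h = Some (dual_kind k, p, c'))"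
  by (cases h) (auto simp: compat_def)

lemma compat_None [simp]: "compat None None"
  by (simp add: compat_def)

lemma head_lift_None [simp]: "head_lift t h = None \<longleftrightarrow> h = None"
  and head_unfold_None [simp]: "head_unfold h = None \<longleftrightarrow> h = None"
  by (auto simp: head_lift_def head_unfold_def)

lemma head_lift_simps [simp]:
  "head_lift t None = None" "head_lift t (Some (k, p, c)) = Some (k, p + t, c)"
  by (auto simp: head_lift_def)

lemma head_unfold_simps [simp]:
  "head_unfold None = None" "head_unfold (Some (k, p, c)) = Some (k, p, c - 1)"
  by (auto simp: head_unfold_def)

lemma above_simps [simp]: "above p None" "above p (Some (k, q, c)) \<longleftrightarrow> p < q"
  by (auto simp: above_def)

lemma unfoldable_simps [simp]: "unfoldable None" "unfoldable (Some (k, p, c)) \<longleftrightarrow> 0 < c"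
  by (auto simp: unfoldable_def)

lemma head_lift_unfold: "head_lift t (head_unfold h) = head_unfold (head_lift t h)"
  by (cases h) auto

lemma head_lift_lift: "head_lift t (head_lift s h) = head_lift s (head_lift t h)"
  by (cases h) auto

lemma above_lift: "above p h \<Longrightarrow> above (p + t) (head_lift t h)"
  by (cases h) auto

lemma unfoldable_lift: "unfoldable h \<Longrightarrow> unfoldable (head_lift t h)"
  by (cases h) auto

lemma compat_lift: "compat h h' \<Longrightarrow> compat (head_lift t h) (head_lift t h')"
  by (cases h; cases h') (auto simp: compat_def)

lemma compat_unfold: "compat (head_unfold h) h' = compat h h'" "compat h (head_unfold h') = compat h h'"
  by (cases h; cases h'; auto simp: compat_def)+

lemma head_type_lift: "head (lift t A) = head_lift t (head A)"
  by (induction A) (auto simp: head_lift_def map_option_case split: option.splits)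

lemma head_tren [simp]: "head (tren f A) = head A"
  by (induction A arbitrary: f) auto

lemma head_tsub_Some: "head A = Some h \<Longrightarrow> head (tsub s A) = Some h"
  by (induction A arbitrary: s h) auto

lemma head_tsub_None: "head A = None \<Longrightarrow> (\<And>X. head (s X) = None) \<Longrightarrow> head (tsub s A) = None"
proof (induction A arbitrary: s)
  case (Mu A)
  have "head (tsub (case_nat (TVar 0) (\<lambda>n. tren Suc (s n))) A) = None"
  proof (rule Mu.IH)
    show "head (case_nat (TVar 0) (\<lambda>n. tren Suc (s n)) X) = None" for X
      using Mu.prems(2) by (cases X) auto
  qed (use Mu.prems in simp)
  then show ?case by simp
qed auto

text \<open>If \<open>A\<close> has a connective at its head, substitution acts only below it.
  Otherwise the head is \<open>Done\<close> or a variable, and \<open>Mu (lift t A)\<close>, which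
  may replace the variable, has no connective either. So \<open>t\<close> leaves no trace in the
  head.\<close>

lemma head_unfold_type: "head (unfold t A) = head A"
proof (cases "head A")
  case None
  have "head (tsub (case_nat (Mu (lift t A)) TVar) A) = None"
  proof (rule head_tsub_None[OF None])
    show "head (case_nat (Mu (lift t A)) TVar X) = None" for X
      using None by (cases X) (auto simp: head_type_lift)
  qed
  with None show ?thesis by (simp add: unfold_def)
qed (simp add: unfold_def head_tsub_Some)

lemma head_unfold_Mu: "head_unfold (head (Mu A)) = head A"
  by (cases "head A") auto

lemma unfoldable_Mu: "unfoldable (head (Mu A))"
  by (cases "head A") auto

lemma compat_dual: "compat (head A) (head (dual A))"
  by (induction A) (auto simp: compat_def map_option_case split: option.splits)

lemma pr_head: "pr A = (case head A of None \<Rightarrow> \<infinity> | Some (k, p, c) \<Rightarrow> enat p)"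
  by (induction A) (auto split: option.splits)

lemma pr_dual [simp]: "pr (dual A) = pr A"
  by (induction A) auto

lemma above_head: "enat p < pr A \<Longrightarrow> above p (head A)"
  by (auto simp: pr_head above_def)

text \<open>\<open>ht P \<Omega> S g\<close> types what \<open>P\<close> exposes. The linear names are the elements of \<open>S\<close>, and \<open>g\<close>
  gives their heads. The set \<open>S\<close> cannot be replaced by \<open>fn P\<close>: a branch without
  alternatives holds names that do not occur in it.\<close>

primrec ht :: "proc \<Rightarrow> hd list list \<Rightarrow> name set \<Rightarrow> (name \<Rightarrow> hd) \<Rightarrow> bool" where
  "ht (Send x a b) \<Omega> S g \<longleftrightarrow>
     distinct [x, a, b] \<and> {x, a, b} \<subseteq> S \<and>
     (\<exists>p. g x = Some (KTensor, p, 0) \<and> above p (g a) \<and> above p (g b)) \<and>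
     (\<forall>i \<in> S. i \<notin> {x, a, b} \<longrightarrow> g i = None)"
| "ht (Recv x P) \<Omega> S g \<longleftrightarrow>
     x \<in> S \<and> {i. i + 2 \<in> fn P} \<subseteq> S - {x} \<and>
     (\<exists>p. g x = Some (KParr, p, 0) \<and> (\<forall>i \<in> S. i \<notin> {x} \<longrightarrow> above p (g i)))"
| "ht (Sel x b l) \<Omega> S g \<longleftrightarrow>
     x \<noteq> b \<and> {x, b} \<subseteq> S \<and>
     (\<exists>p L. g x = Some (KPlus L, p, 0) \<and> l |\<in>| L \<and> above p (g b)) \<and>
     (\<forall>i \<in> S. i \<notin> {x, b} \<longrightarrow> g i = None)"
| "ht (Bra x Ps) \<Omega> S g \<longleftrightarrow>
     x \<in> S \<and> (\<forall>P \<in> fset (fmran Ps). {i. Suc i \<in> fn P} \<subseteq> S - {x}) \<and>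
     (\<exists>p. g x = Some (KWith (fmdom Ps), p, 0) \<and> (\<forall>i \<in> S. i \<notin> {x} \<longrightarrow> above p (g i)))"
| "ht (Res P) \<Omega> S g \<longleftrightarrow>
     (\<exists>h h'. compat h h' \<and> ht P \<Omega> ({0, 1} \<union> shift2 ` S) (case_nat h (case_nat h' g)))"
| "ht (Par P Q) \<Omega> S g \<longleftrightarrow> (\<exists>S1 S2. S = S1 \<union> S2 \<and> S1 \<inter> S2 = {} \<and> ht P \<Omega> S1 g \<and> ht Q \<Omega> S2 g)"
| "ht Inact \<Omega> S g \<longleftrightarrow> (\<forall>i \<in> S. g i = None)"
| "ht (Fwd x y) \<Omega> S g \<longleftrightarrow> x \<noteq> y \<and> {x, y} \<subseteq> S \<and> (\<forall>i \<in> S. i \<notin> {x, y} \<longrightarrow> g i = None)"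
| "ht (Rec zs P) \<Omega> S g \<longleftrightarrow>
     distinct zs \<and> set zs \<subseteq> S \<and> (\<forall>i \<in> S. i \<notin> set zs \<longrightarrow> g i = None) \<and>
     (\<forall>i \<in> set zs. unfoldable (g i)) \<and>
     ht P (map g zs # \<Omega>) (set zs) (head_unfold \<circ> g)"
| "ht (Call X zs) \<Omega> S g \<longleftrightarrow>
     X < length \<Omega> \<and> distinct zs \<and> set zs \<subseteq> S \<and> (\<forall>i \<in> S. i \<notin> set zs \<longrightarrow> g i = None) \<and>
     (\<exists>t. map g zs = map (head_lift t) (\<Omega> ! X))"

section \<open>Weakening, renaming, lifting and loop substitution for head typing\<close>

lemma above_weaken:
  assumes "\<forall>i \<in> S. i \<notin> X \<longrightarrow> above p (g i)" "\<forall>i \<in> T. i \<notin> S \<longrightarrow> g i = None"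
  shows "\<forall>i \<in> T. i \<notin> X \<longrightarrow> above p (g i)"
  using assms by (metis above_simps(1))

text \<open>Counterpart of \<open>typ_end\<close>: a linear name without connective may be added to
  any process.\<close>

lemma ht_weaken:
  assumes "ht P \<Omega> S g" "S \<subseteq> T" "\<forall>i \<in> T. i \<notin> S \<longrightarrow> g i = None"
  shows "ht P \<Omega> T g"
  using assms
proof (induction P arbitrary: \<Omega> S T g)
  case (Recv x P)
  then show ?case
    using above_weaken[OF _ Recv.prems(3)] by (simp only: ht.simps) blast
next
  case (Bra x Ps)
  then show ?case
    using above_weaken[OF _ Bra.prems(3)] by (simp only: ht.simps) blast
next
  case (Res P)
  then obtain h h' where h: "compat h h'" "ht P \<Omega> ({0, 1} \<union> shift2 ` S) (case_nat h (case_nat h' g))"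
    by auto
  have "ht P \<Omega> ({0, 1} \<union> shift2 ` T) (case_nat h (case_nat h' g))"
    by (rule Res.IH[OF h(2)]) (use Res.prems in \<open>auto simp: image_iff\<close>)
  with h(1) show ?case by auto
next
  case (Par P Q)
  then obtain S1 S2 where S: "S = S1 \<union> S2" "S1 \<inter> S2 = {}" "ht P \<Omega> S1 g" "ht Q \<Omega> S2 g" by auto
  \<comment> \<open>All additional names are given to the left component.\<close>
  have "ht P \<Omega> (T - S2) g" by (rule Par.IH(1)[OF S(3)]) (use S Par.prems in auto)
  with S(4) show ?case unfolding ht.simps
    by (intro exI[of _ "T - S2"] exI[of _ S2]) (use S(1) Par.prems(2) in auto)
next
  case (Rec zs P)
  then show ?case by (simp only: ht.simps) blast
next
  case (Call X zs)
  then show ?case by (simp only: ht.simps) blast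
qed (simp_all, blast+)

text \<open>Injectivity is asked on the linear names only: neither \<open>replace zs ys\<close>,
  used for unfolding, nor \<open>\<lambda>i. \<sigma> i - 2\<close>, used to leave the scope of a
  restriction, is injective on all names.\<close>

lemma ht_ren:
  "ht P \<Omega> S g \<Longrightarrow> inj_on f S \<Longrightarrow> (\<And>i. i \<in> S \<Longrightarrow> g' (f i) = g i) \<Longrightarrow> ht (ren f P) \<Omega> (f ` S) g'"
proof (induction P arbitrary: \<Omega> S g f g')
  case (Send x a b)
  then show ?case by (auto simp: inj_on_eq_iff)
next
  case (Sel x b l)
  then show ?case by (auto simp: inj_on_eq_iff)
next
  case (Fwd x y)
  then show ?case by (auto simp: inj_on_eq_iff)
next
  case (Recv x P)
  then obtain p where p: "x \<in> S" "g x = Some (KParr, p, 0)" "\<forall>i \<in> S. i \<notin> {x} \<longrightarrow> above p (g i)"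
    and sub: "{i. i + 2 \<in> fn P} \<subseteq> S - {x}" by auto
  have "{i. i + 2 \<in> fn (ren (up (up f)) P)} \<subseteq> f ` {i. i + 2 \<in> fn P}"
    using fn_ren[of "up (up f)" P] up_up_image by blast
  also have "\<dots> \<subseteq> f ` S - {f x}"
    using sub p(1) Recv.prems(2) by (auto simp: inj_on_eq_iff)
  finally show ?case using p Recv.prems(3) by auto
next
  case (Bra x Ps)
  then obtain p where p: "x \<in> S" "g x = Some (KWith (fmdom Ps), p, 0)"
      "\<forall>i \<in> S. i \<notin> {x} \<longrightarrow> above p (g i)"
    and sub: "\<And>P. P |\<in>| fmran Ps \<Longrightarrow> {i. Suc i \<in> fn P} \<subseteq> S - {x}" by auto
  have "{i. Suc i \<in> fn (ren (up f) P)} \<subseteq> f ` S - {f x}" if "P |\<in>| fmran Ps" for P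
  proof
    fix i assume "i \<in> {i. Suc i \<in> fn (ren (up f) P)}"
    then obtain j where j: "j \<in> fn P" "Suc i = up f j" using fn_ren[of "up f" P] by auto
    then obtain k where k: "j = Suc k" "i = f k" by (cases j) auto
    then have "k \<in> S - {x}" using j(1) sub[OF that] by auto
    then show "i \<in> f ` S - {f x}" using k(2) p(1) Bra.prems(2) by (auto simp: inj_on_eq_iff)
  qed
  then show ?case using p Bra.prems(3) by auto
next
  case (Res P)
  then obtain h h' where h: "compat h h'" "ht P \<Omega> ({0, 1} \<union> shift2 ` S) (case_nat h (case_nat h' g))"
    by auto
  have "ht (ren (up (up f)) P) \<Omega> (up (up f) ` ({0, 1} \<union> shift2 ` S)) (case_nat h (case_nat h' g'))"
  proof (rule Res.IH[OF h(2)])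
    show "inj_on (up (up f)) ({0, 1} \<union> shift2 ` S)"
      using Res.prems(2) by (auto simp: inj_on_def)
  qed (use Res.prems(3) in auto)
  moreover have "up (up f) ` ({0, 1} \<union> shift2 ` S) = {0, 1} \<union> shift2 ` f ` S"
    by (simp add: image_Un image_image)
  ultimately show ?case using h(1) by auto
next
  case (Par P Q)
  then obtain S1 S2 where S: "S = S1 \<union> S2" "S1 \<inter> S2 = {}" "ht P \<Omega> S1 g" "ht Q \<Omega> S2 g" by auto
  have "ht (ren f P) \<Omega> (f ` S1) g'" "ht (ren f Q) \<Omega> (f ` S2) g'"
    by (rule Par.IH[where g = g]; use S Par.prems in \<open>auto intro: inj_on_subset\<close>)+
  moreover have "f ` S1 \<inter> f ` S2 = {}"
    using S Par.prems(2) by (metis inj_on_image_Int image_empty Un_upper1 Un_upper2)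
  ultimately show ?case using S by (auto simp: image_Un)
next
  case (Rec zs P)
  have eq: "map g' (map f zs) = map g zs" using Rec.prems by auto
  have "ht (ren f P) (map g zs # \<Omega>) (f ` set zs) (head_unfold \<circ> g')"
    by (rule Rec.IH[where g = "head_unfold \<circ> g"]) (use Rec.prems in \<open>auto simp: comp_def intro: inj_on_subset\<close>)
  with Rec.prems show ?case unfolding ren.simps ht.simps eq
    by (auto simp: distinct_map intro: inj_on_subset)
next
  case (Call X zs)
  then have eq: "map g' (map f zs) = map g zs" by auto
  from Call have "inj_on f (set zs)" by (auto intro: inj_on_subset)
  with Call.prems show ?case unfolding ren.simps ht.simps eq by (auto simp: distinct_map)
qed auto

lemma ht_cong: "ht P \<Omega> S g \<Longrightarrow> (\<And>i. i \<in> S \<Longrightarrow> g' i = g i) \<Longrightarrow> ht P \<Omega> S g'"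
  using ht_ren[of P \<Omega> S g id g'] by simp

lemma ht_append: "ht P \<Omega> S g \<Longrightarrow> ht P (\<Omega> @ \<Omega>') S g"
proof (induction P arbitrary: \<Omega> S g)
  case (Res P)
  then obtain h h' where "compat h h'" "ht P \<Omega> ({0, 1} \<union> shift2 ` S) (case_nat h (case_nat h' g))"
    by auto
  with Res.IH[OF this(2)] show ?case by auto
next
  case (Par P Q)
  then obtain S1 S2 where "S = S1 \<union> S2" "S1 \<inter> S2 = {}" "ht P \<Omega> S1 g" "ht Q \<Omega> S2 g" by auto
  with Par.IH(1)[OF this(3)] Par.IH(2)[OF this(4)] show ?case by auto
next
  case (Rec zs P)
  then show ?case using Rec.IH[of "map g zs # \<Omega>"] by auto
next
  case (Call X zs)
  then show ?case by (auto simp: nth_append)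
qed simp_all

text \<open>Priorities are only compared with each other, so a uniform shift preserves all
  conditions. This provides the copy of a loop that a call with lifted types needs.\<close>

lemma ht_lift: "ht P \<Omega> S g \<Longrightarrow> ht P (map (map (head_lift t)) \<Omega>) S (head_lift t \<circ> g)"
proof (induction P arbitrary: \<Omega> S g)
  case (Send x a b)
  then show ?case by (auto intro!: above_lift)
next
  case (Recv x P)
  then show ?case by (auto intro!: above_lift)
next
  case (Sel x b l)
  then show ?case by (auto intro!: above_lift)
next
  case (Bra x Ps)
  then show ?case by (auto intro!: above_lift)
next
  case (Res P)
  then obtain h h' where h: "compat h h'" "ht P \<Omega> ({0, 1} \<union> shift2 ` S) (case_nat h (case_nat h' g))"
    by auto
  have "ht P (map (map (head_lift t)) \<Omega>) ({0, 1} \<union> shift2 ` S)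
      (case_nat (head_lift t h) (case_nat (head_lift t h') (head_lift t \<circ> g)))"
    by (rule ht_cong[OF Res.IH[OF h(2)]]) auto
  with compat_lift[OF h(1)] show ?case unfolding ht.simps by blast
next
  case (Par P Q)
  then obtain S1 S2 where "S = S1 \<union> S2" "S1 \<inter> S2 = {}" "ht P \<Omega> S1 g" "ht Q \<Omega> S2 g" by auto
  with Par.IH(1)[OF this(3)] Par.IH(2)[OF this(4)] show ?case by auto
next
  case (Rec zs P)
  then have "ht P (map (head_lift t \<circ> g) zs # map (map (head_lift t)) \<Omega>) (set zs)
      (head_lift t \<circ> (head_unfold \<circ> g))"
    using Rec.IH[of "map g zs # \<Omega>" "set zs" "head_unfold \<circ> g"] by (simp add: comp_def)
  then have "ht P (map (head_lift t \<circ> g) zs # map (map (head_lift t)) \<Omega>) (set zs)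
      (head_unfold \<circ> (head_lift t \<circ> g))"
    by (rule ht_cong) (simp add: head_lift_unfold)
  with Rec.prems show ?case by (auto simp: comp_def intro: unfoldable_lift)
next
  case (Call X zs)
  then obtain s where "map g zs = map (head_lift s) (\<Omega> ! X)" by auto
  then have "map (head_lift t) (map g zs) = map (head_lift t) (map (head_lift s) (\<Omega> ! X))" by simp
  \<comment> \<open>Lifts commute, so the call keeps its own lift \<open>s\<close>.\<close>
  then have "map (head_lift t \<circ> g) zs = map (head_lift s) (map (map (head_lift t)) \<Omega> ! X)"
    using Call.prems by (simp add: head_lift_lift)
  then have "\<exists>s. map (head_lift t \<circ> g) zs = map (head_lift s) (map (map (head_lift t)) \<Omega> ! X)" ..
  with Call.prems show ?case unfolding ht.simps length_map by simp
qed auto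

text \<open>At a call, the typing of the closed loop is lifted by the amount chosen there, renamed
  from \<open>zs\<close> to the arguments, and weakened by the remaining recursion variables and
  headless names. Under a prefix, only the free names matter, and \<open>psub_wf_rec\<close> bounds
  them.\<close>

lemma ht_psub:
  assumes "ht P (\<Omega> @ [map g0 zs]) S g" "wf_rec P (map length \<Omega> @ [length zs])"
    and "wf_rec (Rec zs B) []" "ht (Rec zs B) [] (set zs) g0"
  shows "ht (psub (length \<Omega>) zs B P) \<Omega> S g"
  using assms
proof (induction P arbitrary: \<Omega> S g g0 zs B)
  case (Recv x P)
  have "wf_rec (ren shift2 (Rec zs B)) []" using Recv.prems(3) by (rule wf_rec_ren)
  then have "fn (psub (length \<Omega>) (map shift2 zs) (ren shift2 B) P) \<subseteq> fn P"
    using Recv.prems(2) psub_wf_rec[of P "map length \<Omega>" "map shift2 zs" "ren shift2 B"] by simp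
  with Recv.prems(1) show ?case unfolding ht.simps psub.simps by blast
next
  case (Bra x Ps)
  have "wf_rec (ren Suc (Rec zs B)) []" using Bra.prems(3) by (rule wf_rec_ren)
  then have "fn (psub (length \<Omega>) (map Suc zs) (ren Suc B) P) \<subseteq> fn P" if "P |\<in>| fmran Ps" for P
    using Bra.prems(2) that psub_wf_rec[of P "map length \<Omega>" "map Suc zs" "ren Suc B"] by auto
  then have "{i. Suc i \<in> fn (psub (length \<Omega>) (map Suc zs) (ren Suc B) P)} \<subseteq> S - {x}"
    if "P |\<in>| fmran Ps" for P
    using that Bra.prems(1) unfolding ht.simps by blast
  with Bra.prems(1) show ?case by simp
next
  case (Res P)
  then obtain h h' where h: "compat h h'"
      "ht P (\<Omega> @ [map g0 zs]) ({0, 1} \<union> shift2 ` S) (case_nat h (case_nat h' g))"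
    by auto
  have "ht (psub (length \<Omega>) (map shift2 zs) (ren shift2 B) P) \<Omega>
      ({0, 1} \<union> shift2 ` S) (case_nat h (case_nat h' g))"
  proof (rule Res.IH)
    \<comment> \<open>The loop moves under the binder: its names are shifted and its heads are read
      off at the shifted names, which leaves the entry of the recursion context as it was.\<close>
    show "ht P (\<Omega> @ [map (\<lambda>i. g0 (i - 2)) (map shift2 zs)]) ({0, 1} \<union> shift2 ` S) (case_nat h (case_nat h' g))"
      using h(2) by (simp add: comp_def)
    show "wf_rec P (map length \<Omega> @ [length (map shift2 zs)])" using Res.prems(2) by simp
    show "wf_rec (Rec (map shift2 zs) (ren shift2 B)) []"
      using wf_rec_ren[OF Res.prems(3), of shift2] by simp
    have "ht (ren shift2 (Rec zs B)) [] (shift2 ` set zs) (\<lambda>i. g0 (i - 2))"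
      by (rule ht_ren[OF Res.prems(4)]) (auto simp: inj_on_def)
    then show "ht (Rec (map shift2 zs) (ren shift2 B)) [] (set (map shift2 zs)) (\<lambda>i. g0 (i - 2))"
      by simp
  qed
  with h(1) show ?case by auto
next
  case (Par P Q)
  from Par.prems(1) obtain S1 S2 where S: "S = S1 \<union> S2" "S1 \<inter> S2 = {}"
    "ht P (\<Omega> @ [map g0 zs]) S1 g" "ht Q (\<Omega> @ [map g0 zs]) S2 g" by auto
  from Par.prems(2) have "wf_rec P (map length \<Omega> @ [length zs])" "wf_rec Q (map length \<Omega> @ [length zs])"
    by auto
  then have "ht (psub (length \<Omega>) zs B P) \<Omega> S1 g" "ht (psub (length \<Omega>) zs B Q) \<Omega> S2 g"
    using S Par.IH[OF _ _ Par.prems(3,4)] by blast+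
  with S show ?case by auto
next
  case (Rec ws P)
  have "pren (up Suc) B = B"
    using Rec.prems(3) by (intro pren_wf_rec[of _ "[length zs]"]) auto
  moreover have "ht (psub (length (map g ws # \<Omega>)) zs B P) (map g ws # \<Omega>) (set ws) (head_unfold \<circ> g)"
    by (rule Rec.IH[OF _ _ Rec.prems(3,4)]) (use Rec.prems(1,2) in \<open>auto simp: comp_def\<close>)
  ultimately show ?case using Rec.prems(1) by auto
next
  case (Call X ys)
  show ?case
  proof (cases "X = length \<Omega>")
    case True
    from Call.prems(1) have ys: "distinct ys" "set ys \<subseteq> S" "\<forall>i \<in> S. i \<notin> set ys \<longrightarrow> g i = None"
      and "\<exists>t. map g ys = map (head_lift t) (map g0 zs)"
      unfolding True ht.simps nth_append_length by - (elim conjE, assumption)+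
    then obtain t where t: "map g ys = map (head_lift t) (map g0 zs)" by blast
    have len: "length zs = length ys" using True Call.prems(2) by (simp add: nth_append)
    have zs: "distinct zs" using Call.prems(4) by simp
    let ?f = "replace zs ys"
    have map_f: "map ?f zs = ys" using map_replace[OF zs len] .
    have inj: "inj_on ?f (set zs)" using ys(1) distinct_map[of ?f zs] unfolding map_f by simp
    have "ht (Rec zs B) [] (set zs) (head_lift t \<circ> g0)"
      using ht_lift[OF Call.prems(4), of t] by simp
    then have "ht (ren ?f (Rec zs B)) [] (?f ` set zs) g"
    proof (rule ht_ren[OF _ inj])
      have "map (g \<circ> ?f) zs = map (head_lift t \<circ> g0) zs"
        using t unfolding map_map[symmetric] map_f .
      then show "g (?f i) = (head_lift t \<circ> g0) i" if "i \<in> set zs" for i using that by auto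
    qed
    then have "ht (ren ?f (Rec zs B)) ([] @ \<Omega>) (set ys) g"
      unfolding set_map[symmetric] map_f by (rule ht_append)
    then have "ht (ren ?f (Rec zs B)) \<Omega> S g" using ys(2,3) by (simp only: append_Nil) (rule ht_weaken)
    then show ?thesis using True map_f by simp
  next
    case False
    then show ?thesis using Call.prems by (auto simp: nth_append)
  qed
qed auto

lemma ht_unfold:
  assumes "ht (Rec zs B) [] S g" "wf_rec (Rec zs B) []"
  shows "ht (psub 0 zs B B) [] (set zs) (head_unfold \<circ> g) \<and> wf_rec (psub 0 zs B B) []"
proof
  have "ht (Rec zs B) [] (set zs) g" using assms(1) by simp
  then show "ht (psub 0 zs B B) [] (set zs) (head_unfold \<circ> g)"
    using ht_psub[of B "[]" g zs] assms by simp
  show "wf_rec (psub 0 zs B B) []"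
    using psub_wf_rec[of B "[]" zs B] assms(2) by simp
qed

section \<open>From session types to heads\<close>

declare head.simps(6) [simp del]

text \<open>Names outside the context get the head \<open>None\<close>, as names of type
  \<open>Done\<close> do; the set argument of \<open>ht\<close> tells the two apart.\<close>

definition head_ctx :: "ctx \<Rightarrow> name \<Rightarrow> hd" where
  "head_ctx \<Gamma> i = Option.bind (\<Gamma> i) head"

lemma bind_simps [simp]: "(A \<bullet> \<Gamma>) 0 = Some A" "(A \<bullet> \<Gamma>) (Suc i) = \<Gamma> i"
  by (auto simp: bind_def)

lemma dom_bind: "dom (A \<bullet> \<Gamma>) = insert 0 (Suc ` dom \<Gamma>)"
proof (rule set_eqI)
  show "i \<in> dom (A \<bullet> \<Gamma>) \<longleftrightarrow> i \<in> insert 0 (Suc ` dom \<Gamma>)" for i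
    by (cases i) auto
qed

lemma head_ctx_bind: "head_ctx (A \<bullet> \<Gamma>) = case_nat (head A) (head_ctx \<Gamma>)"
proof
  show "head_ctx (A \<bullet> \<Gamma>) i = case_nat (head A) (head_ctx \<Gamma>) i" for i
    by (cases i) (auto simp: head_ctx_def)
qed

lemma below_above: "below p \<Gamma> \<Longrightarrow> above p (head_ctx \<Gamma> i)"
  by (cases "\<Gamma> i") (auto simp: head_ctx_def below_def ran_def intro: above_head)

lemma head_ctx_zip:
  "head_ctx (map_of (zip zs (map f As))) i = Option.bind (map_of (zip zs As) i) (head \<circ> f)"
  by (cases "map_of (zip zs As) i") (auto simp: head_ctx_def zip_map2 map_of_map)

lemma map_head_ctx_zip:
  "distinct zs \<Longrightarrow> length zs = length As \<Longrightarrow>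
   map (head_ctx (map_of (zip zs (map f As)))) zs = map (head \<circ> f) As"
  by (rule nth_equalityI) (auto simp: head_ctx_zip map_of_zip_nth)

definition loop_head :: "type \<Rightarrow> hd" where
  "loop_head A = head (Mu A)"

text \<open>The bound on free names is part of the induction because the prefix clauses of
  \<open>ht\<close> and the loop clause of \<open>wf_rec\<close> ask for it.\<close>

lemma typed_ht:
  "\<Omega> \<turnstile> P \<triangleright> \<Gamma> \<Longrightarrow>
   ht P (map (map loop_head) \<Omega>) (dom \<Gamma>) (head_ctx \<Gamma>) \<and> wf_rec P (map length \<Omega>) \<and> fn P \<subseteq> dom \<Gamma>"
proof (induction rule: typed.induct)
  case (typ_send x y z p A B \<Omega>)
  then show ?case by (auto simp: head_ctx_def intro: above_head)
next
  case (typ_recv \<Omega> P A B \<Gamma> x p)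
  have "{i. i + 2 \<in> fn P} \<subseteq> dom \<Gamma>" using typ_recv.IH by (auto simp: dom_bind)
  moreover have "above p (head_ctx (\<Gamma>(x \<mapsto> Parr p A B)) i)" if "i \<noteq> x" for i
    using below_above[OF \<open>below p \<Gamma>\<close>, of i] that by (simp add: head_ctx_def)
  ultimately show ?case using typ_recv by (auto simp: head_ctx_def)
next
  case (typ_sel x z As j A p \<Omega>)
  then show ?case by (auto simp: head_ctx_def fmlookup_dom_iff intro: above_head)
next
  case (typ_bra Ps As \<Omega> \<Gamma> x p)
  have br: "wf_rec P (map length \<Omega>) \<and> {i. Suc i \<in> fn P} \<subseteq> dom \<Gamma>" if P: "P |\<in>| fmran Ps" for P
  proof -
    obtain l where l: "fmlookup Ps l = Some P" using P by (auto simp: fmlookup_ran_iff)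
    then obtain A where "fmlookup As l = Some A"
      using typ_bra(1) by (metis fmlookup_dom_iff)
    from typ_bra.IH[OF l this] have "wf_rec P (map length \<Omega>)" "fn P \<subseteq> dom (A \<bullet> \<Gamma>)" by simp_all
    then show ?thesis by (auto simp: dom_bind)
  qed
  moreover have "\<exists>A. \<Gamma> i = Some A" if "P |\<in>| fmran Ps" "Suc i \<in> fn P" for P i
    using br[OF that(1)] that(2) by auto
  moreover have "above p (head_ctx (\<Gamma>(x \<mapsto> With p As)) i)" if "i \<noteq> x" for i
    using below_above[OF \<open>below p \<Gamma>\<close>, of i] that by (simp add: head_ctx_def)
  ultimately show ?case using br typ_bra.hyps by (auto simp: head_ctx_def)
next
  case (typ_end \<Omega> P \<Gamma> x)
  have "ht P (map (map loop_head) \<Omega>) (dom \<Gamma>) (head_ctx (\<Gamma>(x \<mapsto> Done)))"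
    by (rule ht_cong[OF conjunct1[OF typ_end.IH]]) (use typ_end in \<open>auto simp: head_ctx_def\<close>)
  then have "ht P (map (map loop_head) \<Omega>) (dom (\<Gamma>(x \<mapsto> Done))) (head_ctx (\<Gamma>(x \<mapsto> Done)))"
    by (rule ht_weaken) (auto simp: head_ctx_def)
  moreover have "fn P \<subseteq> dom (\<Gamma>(x \<mapsto> Done))" using typ_end.IH by auto
  ultimately show ?case using typ_end.IH by blast
next
  case (typ_inact \<Omega>)
  then show ?case by simp
next
  case (typ_par \<Omega> P \<Gamma> Q \<Delta>)
  have "ht P (map (map loop_head) \<Omega>) (dom \<Gamma>) (head_ctx (\<Gamma> ++ \<Delta>))"
  proof (rule ht_cong)
    show "head_ctx (\<Gamma> ++ \<Delta>) i = head_ctx \<Gamma> i" if "i \<in> dom \<Gamma>" for i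
      using typ_par(3) that by (auto simp: head_ctx_def map_add_def split: option.splits)
  qed (use typ_par in auto)
  moreover have "ht Q (map (map loop_head) \<Omega>) (dom \<Delta>) (head_ctx (\<Gamma> ++ \<Delta>))"
  proof (rule ht_cong)
    show "head_ctx (\<Gamma> ++ \<Delta>) i = head_ctx \<Delta> i" if "i \<in> dom \<Delta>" for i
      using that by (auto simp: head_ctx_def)
  qed (use typ_par in auto)
  ultimately have "ht (Par P Q) (map (map loop_head) \<Omega>) (dom (\<Gamma> ++ \<Delta>)) (head_ctx (\<Gamma> ++ \<Delta>))"
    using typ_par(3) by (simp only: ht.simps) (metis dom_map_add Un_commute)
  then show ?case using typ_par by auto
next
  case (typ_res \<Omega> P A \<Gamma>)
  then show ?case by (auto simp: dom_bind head_ctx_bind image_image intro: compat_dual)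
next
  case (typ_fwd x y \<Omega> A)
  then show ?case by auto
next
  case (typ_rec As \<Omega> P zs t)
  let ?g = "head_ctx (map_of (zip zs (map Mu As)))"
  \<comment> \<open>Here the lift of the typing rule disappears: seen from its head, an unfolded
    type is the recursive type minus one \<open>Mu\<close>.\<close>
  have body: "head_ctx (map_of (zip zs (map (unfold t) As))) = head_unfold \<circ> ?g"
  proof
    show "head_ctx (map_of (zip zs (map (unfold t) As))) i = (head_unfold \<circ> ?g) i" for i
      by (cases "map_of (zip zs As) i")
        (simp_all add: head_ctx_zip head_unfold_type head_unfold_Mu)
  qed
  have "unfoldable (?g i)" for i
    by (cases "map_of (zip zs As) i") (simp_all add: head_ctx_zip unfoldable_Mu)
  moreover have "dom (map_of (zip zs (map f As))) = set zs" for f :: "type \<Rightarrow> type"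
    using typ_rec by simp
  moreover have "map ?g zs = map loop_head As"
    using typ_rec by (simp add: map_head_ctx_zip loop_head_def)
  ultimately show ?case using typ_rec by (auto simp: body comp_def)
next
  case (typ_call X \<Omega> As zs t)
  have "map (head_ctx (map_of (zip zs (map (\<lambda>A. Mu (lift t A)) As)))) zs
      = map (head_lift t) (map (map loop_head) \<Omega> ! X)"
    using typ_call by (simp add: map_head_ctx_zip loop_head_def head_type_lift[symmetric])
  with typ_call show ?case by auto
qed

lemma ht_fn: "ht P \<Omega> S g \<Longrightarrow> fn P \<subseteq> S"
proof (induction P arbitrary: \<Omega> S g)
  case (Bra x Ps)
  then have "x \<in> S" "\<And>P i. P |\<in>| fmran Ps \<Longrightarrow> Suc i \<in> fn P \<Longrightarrow> i \<in> S" by auto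
  then show ?case by auto
next
  case (Res P)
  then obtain h h' where "ht P \<Omega> ({0, 1} \<union> shift2 ` S) (case_nat h (case_nat h' g))" by auto
  from Res.IH[OF this] show ?case by auto
next
  case (Par P Q)
  then obtain S1 S2 where "S = S1 \<union> S2" "ht P \<Omega> S1 g" "ht Q \<Omega> S2 g" by auto
  with Par.IH(1)[OF this(2)] Par.IH(2)[OF this(3)] show ?case by auto
next
  case (Rec zs P)
  then have "ht P (map g zs # \<Omega>) (set zs) (head_unfold \<circ> g)" "set zs \<subseteq> S" by auto
  with Rec.IH[OF this(1)] show ?case by auto
qed auto

primrec subject :: "proc \<Rightarrow> name option" where
  "subject (Send x a b) = Some x"
| "subject (Recv x P) = Some x"
| "subject (Sel x b l) = Some x"
| "subject (Bra x Ps) = Some x"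
| "subject (Res P) = None"
| "subject (Par P Q) = None"
| "subject Inact = None"
| "subject (Fwd x y) = None"
| "subject (Rec zs P) = None"
| "subject (Call X zs) = None"

lemma subject_ren: "subject (ren f P) = map_option f (subject P)"
  by (cases P) auto

text \<open>For outputs, the payloads have higher priority and all other names are headless; for
  inputs, the bound is the side condition on the context of the continuation.\<close>

lemma ht_subject:
  assumes "ht P \<Omega> S g" "subject P = Some x"
  obtains k p where "x \<in> S" "g x = Some (k, p, 0)" "\<And>i. i \<in> S \<Longrightarrow> i \<noteq> x \<Longrightarrow> above p (g i)"
proof (cases P)
  case (Send y a b)
  with assms obtain p where "x \<in> S" "g x = Some (KTensor, p, 0)" "above p (g a)" "above p (g b)"
    "\<forall>i \<in> S. i \<notin> {x, a, b} \<longrightarrow> g i = None" by auto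
  then show thesis using that by (metis above_simps(1) insertE singletonD)
next
  case (Sel y b l)
  with assms obtain p L where "x \<in> S" "g x = Some (KPlus L, p, 0)" "above p (g b)"
    "\<forall>i \<in> S. i \<notin> {x, b} \<longrightarrow> g i = None" by auto
  then show thesis using that by (metis above_simps(1) insertE singletonD)
qed (use assms that in auto)


section \<open>Rearranging restrictions\<close>

lemmas [trans] = sc_trans

abbreviation nus :: "nat \<Rightarrow> proc \<Rightarrow> proc" where
  "nus n P \<equiv> (Res ^^ n) P"

lemma nus_Res: "nus n (Res P) = nus (Suc n) P"
  by (simp add: funpow_swap1)

lemma sc_cong_par_right: "Q \<equiv>\<^sub>s R \<Longrightarrow> Par P Q \<equiv>\<^sub>s Par P R"
  by (meson sc_cong_par sc_par_comm sc_trans)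

lemma sc_cong_nus: "P \<equiv>\<^sub>s Q \<Longrightarrow> nus n P \<equiv>\<^sub>s nus n Q"
  by (induction n) (auto intro: sc_cong_res)

lemma red_nus: "P \<longmapsto> Q \<Longrightarrow> nus n P \<longmapsto> nus n Q"
  by (induction n) (auto intro: red_res)

lemma nus_inact: "nus n Inact \<equiv>\<^sub>s Inact"
proof (induction n)
  case (Suc n)
  then show ?case by (auto intro: sc_trans[OF sc_cong_res sc_res_inact])
qed (simp add: sc_refl)

lemma sc_par_left_comm: "Par P (Par Q R) \<equiv>\<^sub>s Par Q (Par P R)"
  by (meson sc_cong_par sc_par_assoc sc_par_comm sc_sym sc_trans)

text \<open>Under \<open>nus n\<close>, the restrictions bind the pairs 0 and 1, 2 and 3, and so on,
  from the inside out. So \<open>partner\<close> maps an endpoint to the other end of its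
  channel.\<close>

definition partner :: "name \<Rightarrow> name" where
  "partner i = (if even i then Suc i else i - 1)"

lemma partner_partner [simp]: "partner (partner i) = i"
  by (auto simp: partner_def)

lemma partner_neq [simp]: "partner i \<noteq> i"
  by (auto simp: partner_def elim: oddE)

lemma partner_less: "i < 2 * n \<Longrightarrow> partner i < 2 * n"
  by (auto simp: partner_def elim: evenE)

lemma partner_shift [simp]: "partner (Suc (Suc i)) = Suc (Suc (partner i))"
  by (auto simp: partner_def elim: oddE)

text \<open>Since the congruence holds for every body, it depends on the renaming alone, and such
  renamings compose.\<close>

definition nus_perm :: "nat \<Rightarrow> (name \<Rightarrow> name) \<Rightarrow> bool" where
  "nus_perm n \<sigma> \<longleftrightarrow> inj \<sigma> \<and> (\<forall>i < 2 * n. \<sigma> i < 2 * n) \<and> (\<forall>P. nus n P \<equiv>\<^sub>s nus n (ren \<sigma> P))"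

lemma nus_perm_id: "nus_perm n id"
  by (auto simp: nus_perm_def sc_refl)

lemma nus_perm_comp: "nus_perm n \<sigma> \<Longrightarrow> nus_perm n \<tau> \<Longrightarrow> nus_perm n (\<tau> \<circ> \<sigma>)"
  unfolding nus_perm_def by (auto simp: ren_ren[symmetric] intro: inj_compose sc_trans)

text \<open>A rearrangement of the outer \<open>n\<close> restrictions leaves an additional
  innermost one in place.\<close>

lemma nus_perm_up:
  assumes "nus_perm n \<sigma>" shows "nus_perm (Suc n) (up (up \<sigma>))"
  unfolding nus_perm_def
proof (intro conjI allI impI)
  show "inj (up (up \<sigma>))" using assms by (auto simp: nus_perm_def intro: inj_up)
  show "up (up \<sigma>) i < 2 * Suc n" if "i < 2 * Suc n" for i
  proof (cases "i < 2")
    case False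
    then have "i - 2 < 2 * n" using that by auto
    then have "\<sigma> (i - 2) < 2 * n" using assms by (auto simp: nus_perm_def)
    then show ?thesis using False by (simp add: up_up)
  qed (simp add: up_up)
  show "nus (Suc n) P \<equiv>\<^sub>s nus (Suc n) (ren (up (up \<sigma>)) P)" for P
  proof -
    have "nus n (Res P) \<equiv>\<^sub>s nus n (ren \<sigma> (Res P))" using assms unfolding nus_perm_def by blast
    then show ?thesis by (simp only: ren.simps nus_Res)
  qed
qed

lemma nus_perm_swap_res: "nus_perm (Suc (Suc n)) swap_res"
  unfolding nus_perm_def
proof (intro conjI allI impI)
  show "inj swap_res" by (auto simp: inj_def swap_res_def split: if_splits)
  show "swap_res i < 2 * Suc (Suc n)" if "i < 2 * Suc (Suc n)" for i
    using that by (auto simp: swap_res_def)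
  show "nus (Suc (Suc n)) P \<equiv>\<^sub>s nus (Suc (Suc n)) (ren swap_res P)" for P
    using sc_cong_nus[OF sc_res_comm, of n P] by (simp only: nus_Res)
qed

lemma nus_perm_swap_ends: "nus_perm (Suc n) swap_ends"
  unfolding nus_perm_def
proof (intro conjI allI impI)
  show "inj swap_ends" by (auto simp: inj_def swap_ends_def split: if_splits)
  show "swap_ends i < 2 * Suc n" if "i < 2 * Suc n" for i
    using that by (auto simp: swap_ends_def)
  show "nus (Suc n) P \<equiv>\<^sub>s nus (Suc n) (ren swap_ends P)" for P
    using sc_cong_nus[OF sc_res_sym, of n P] by (simp only: nus_Res)
qed

lemma nus_perm_pair: "j < n \<Longrightarrow> \<exists>\<sigma>. nus_perm n \<sigma> \<and> \<sigma> (2 * j) = 0 \<and> \<sigma> (Suc (2 * j)) = 1"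
proof (induction j arbitrary: n)
  case 0
  with nus_perm_id[of n] show ?case by (intro exI[of _ "\<lambda>i. i"]) (simp add: id_def)
next
  case (Suc j)
  then obtain m where m: "n = Suc (Suc m)" "j < Suc m" by (cases n; cases "n - 1") auto
  from Suc.IH[OF m(2)] obtain \<sigma> where \<sigma>: "nus_perm (Suc m) \<sigma>" "\<sigma> (2 * j) = 0" "\<sigma> (Suc (2 * j)) = 1"
    by blast
  \<comment> \<open>The lifted \<sigma> brings the pair to 2 and 3; \<open>swap_res\<close> then
    exchanges it with the innermost pair.\<close>
  have "nus_perm n (swap_res \<circ> up (up \<sigma>))"
    using nus_perm_comp[OF nus_perm_up[OF \<sigma>(1)] nus_perm_swap_res] m(1) by simp
  moreover have "(swap_res \<circ> up (up \<sigma>)) (2 * Suc j) = 0"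
      "(swap_res \<circ> up (up \<sigma>)) (Suc (2 * Suc j)) = 1"
    using \<sigma> by (simp_all add: swap_res_def)
  ultimately show ?case by blast
qed

lemma nus_perm_front:
  assumes "x < 2 * n"
  obtains \<sigma> where "nus_perm n \<sigma>" "\<sigma> x = 0" "\<sigma> (partner x) = 1"
proof (cases "even x")
  case True
  then obtain j where "x = 2 * j" by (elim evenE)
  with nus_perm_pair[of j n] assms that show thesis by (auto simp: partner_def)
next
  case False
  then obtain j where j: "x = Suc (2 * j)" by (elim oddE) simp
  with nus_perm_pair[of j n] assms obtain \<sigma> where
    \<sigma>: "nus_perm n \<sigma>" "\<sigma> (2 * j) = 0" "\<sigma> (Suc (2 * j)) = 1" by auto
  obtain m where "n = Suc m" using assms by (cases n) auto
  then have "nus_perm n (swap_ends \<circ> \<sigma>)"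
    using nus_perm_comp[OF \<sigma>(1)] nus_perm_swap_ends by blast
  then show thesis by (rule that) (use \<sigma> j in \<open>auto simp: swap_ends_def partner_def\<close>)
qed

lemma nus_perm_ge2:
  assumes "nus_perm n \<sigma>" "\<sigma> x = 0" "\<sigma> (partner x) = 1" "i \<noteq> x" "i \<noteq> partner x"
  shows "2 \<le> \<sigma> i"
proof -
  have "inj \<sigma>" using assms(1) by (simp add: nus_perm_def)
  then have "\<sigma> i \<noteq> \<sigma> x" "\<sigma> i \<noteq> \<sigma> (partner x)" using assms(4,5) by (simp_all add: inj_eq)
  then show ?thesis using assms(2,3) by simp
qed

text \<open>A renaming that avoids the two innermost names factors through \<open>shift2\<close>,
  which is how scope extrusion and the redexes express that these names do not occur.\<close>

lemma ren_shift2_pred: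
  assumes "\<And>i. i \<in> fn P \<Longrightarrow> 2 \<le> \<sigma> i"
  shows "ren \<sigma> P = ren shift2 (ren (\<lambda>i. \<sigma> i - 2) P)"
  unfolding ren_ren by (rule ren_cong) (use assms in force)

lemma res_par_out:
  assumes "\<And>i. i \<in> fn R \<Longrightarrow> 2 \<le> \<sigma> i"
  shows "Res (Par P (ren \<sigma> R)) \<equiv>\<^sub>s Par (Res P) (ren (\<lambda>i. \<sigma> i - 2) R)"
proof -
  let ?R = "ren (\<lambda>i. \<sigma> i - 2) R"
  have "ren \<sigma> R = ren shift2 ?R" by (rule ren_shift2_pred) (rule assms)
  then have "Res (Par P (ren \<sigma> R)) \<equiv>\<^sub>s Res (Par (ren shift2 ?R) P)"
    by (metis sc_cong_res sc_par_comm)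
  also have "\<dots> \<equiv>\<^sub>s Par ?R (Res P)" by (rule sc_sym[OF sc_res_par])
  also have "\<dots> \<equiv>\<^sub>s Par (Res P) ?R" by (rule sc_par_comm)
  finally show ?thesis .
qed


section \<open>Configurations\<close>

text \<open>A focused view of a closed process \<open>P\<close>: \<open>n\<close> restrictions are
  pulled to the front, \<open>D\<close> is the component in focus and \<open>R\<close> is the rest.
  Every name is bound, hence below \<open>2 * n\<close>, and by linearity the rest owns exactly the
  names not in \<open>S\<close>.\<close>

definition config :: "proc \<Rightarrow> nat \<Rightarrow> (name \<Rightarrow> hd) \<Rightarrow> name set \<Rightarrow> proc \<Rightarrow> proc \<Rightarrow> bool" where
  "config P n g S D R \<longleftrightarrow>
     P \<equiv>\<^sub>s nus n (Par D R) \<and> S \<subseteq> {..<2 * n} \<and>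
     ht D [] S g \<and> ht R [] ({..<2 * n} - S) g \<and> wf_rec D [] \<and> wf_rec R [] \<and>
     (\<forall>i < 2 * n. compat (g i) (g (partner i)))"

lemma config_cong:
  assumes "config P n g S D R" "Par D R \<equiv>\<^sub>s Par D' R'"
    and "ht D' [] S' g" "ht R' [] ({..<2 * n} - S') g" "S' \<subseteq> {..<2 * n}" "wf_rec D' []" "wf_rec R' []"
  shows "config P n g S' D' R'"
  using assms sc_trans[OF _ sc_cong_nus] unfolding config_def by blast

lemma config_par_left:
  assumes "config P n g S (Par D1 D2) R"
  obtains A where "A \<subseteq> S" "config P n g A D1 (Par D2 R)" "config P n g (S - A) D2 (Par D1 R)"
proof -
  let ?U = "{..<2 * n}"
  from assms obtain A B where AB: "S = A \<union> B" "A \<inter> B = {}" "ht D1 [] A g" "ht D2 [] B g"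
    and R: "ht R [] (?U - S) g" "S \<subseteq> ?U" "wf_rec D1 []" "wf_rec D2 []" "wf_rec R []"
    by (auto simp: config_def)
  have "?U - A = B \<union> (?U - S)" "B \<inter> (?U - S) = {}" "?U - B = A \<union> (?U - S)" "A \<inter> (?U - S) = {}"
    using AB R(2) by auto
  then have h: "ht (Par D2 R) [] (?U - A) g" "ht (Par D1 R) [] (?U - B) g"
    unfolding ht.simps using AB R(1) by metis+
  have "config P n g A D1 (Par D2 R)"
    by (rule config_cong[OF assms]) (use AB R h in \<open>auto intro: sc_sym[OF sc_par_assoc]\<close>)
  moreover have "Par (Par D1 D2) R \<equiv>\<^sub>s Par D2 (Par D1 R)"
    by (meson sc_par_left_comm sc_par_assoc sc_sym sc_trans)
  then have "config P n g B D2 (Par D1 R)"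
    by (rule config_cong[OF assms]) (use AB R h in auto)
  moreover have "S - A = B" using AB by auto
  ultimately show thesis using AB(1) by (intro that[of A]) auto
qed

lemma config_swap:
  assumes "config P n g S D R"
  shows "config P n g ({..<2 * n} - S) R D"
proof -
  have "{..<2 * n} - ({..<2 * n} - S) = S" using assms by (auto simp: config_def)
  with assms show ?thesis by (intro config_cong[OF assms sc_par_comm]) (auto simp: config_def)
qed

lemma config_par_inact:
  assumes "config P n g S D R"
  shows "config P n g S D (Par R Inact)"
proof -
  have "ht (Par R Inact) [] T g" if "ht R [] T g" for T
    unfolding ht.simps by (intro exI[of _ T] exI[of _ "{}"]) (use that in auto)
  with assms show ?thesis
    by (intro config_cong[OF assms sc_cong_par_right[OF sc_sym[OF sc_par_inact]]])
      (auto simp: config_def)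
qed

lemma config_left_comm:
  assumes "config P n g S D (Par Q (Par R T))"
  shows "config P n g S D (Par R (Par Q T))"
proof -
  have "ht (Par R (Par Q T)) [] U g" if "ht (Par Q (Par R T)) [] U g" for U
  proof -
    from that obtain A B C where "U = A \<union> (B \<union> C)" "A \<inter> (B \<union> C) = {}" "B \<inter> C = {}"
      "ht Q [] A g" "ht R [] B g" "ht T [] C g" by auto
    then show ?thesis unfolding ht.simps
      by (intro exI[of _ B] exI[of _ "A \<union> C"] conjI exI[of _ A] exI[of _ C]) auto
  qed
  with assms show ?thesis
    by (intro config_cong[OF assms sc_cong_par_right[OF sc_par_left_comm]]) (auto simp: config_def)
qed

text \<open>Scope extrusion makes the restriction in focus the innermost of the prefix, so all
  previous names move up by 2.\<close>

lemma config_res: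
  assumes "config P n g S (Res D) R"
  obtains h h' where
    "config P (Suc n) (case_nat h (case_nat h' g)) ({0, 1} \<union> shift2 ` S) D (ren shift2 R)"
proof -
  from assms obtain h h' where h: "compat h h'"
      "ht D [] ({0, 1} \<union> shift2 ` S) (case_nat h (case_nat h' g))"
    and S: "S \<subseteq> {..<2 * n}" and R: "ht R [] ({..<2 * n} - S) g" "wf_rec D []" "wf_rec R []"
    and g: "\<forall>i < 2 * n. compat (g i) (g (partner i))" and P: "P \<equiv>\<^sub>s nus n (Par (Res D) R)"
    by (auto simp: config_def)
  let ?g = "case_nat h (case_nat h' g)" and ?S = "{0, 1} \<union> shift2 ` S"
  have "Par (Res D) R \<equiv>\<^sub>s Par R (Res D)" by (rule sc_par_comm)
  also have "\<dots> \<equiv>\<^sub>s Res (Par (ren shift2 R) D)" by (rule sc_res_par)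
  also have "\<dots> \<equiv>\<^sub>s Res (Par D (ren shift2 R))" by (intro sc_cong_res sc_par_comm)
  finally have "nus n (Par (Res D) R) \<equiv>\<^sub>s nus (Suc n) (Par D (ren shift2 R))"
    using sc_cong_nus nus_Res by metis
  then have "P \<equiv>\<^sub>s nus (Suc n) (Par D (ren shift2 R))" using P sc_trans by blast
  moreover have "ht (ren shift2 R) [] (shift2 ` ({..<2 * n} - S)) ?g"
    by (rule ht_ren[OF R(1)]) (auto simp: inj_on_def)
  moreover have "shift2 ` ({..<2 * n} - S) = {..<2 * Suc n} - ?S"
  proof (rule set_eqI)
    fix i
    show "i \<in> shift2 ` ({..<2 * n} - S) \<longleftrightarrow> i \<in> {..<2 * Suc n} - ?S"
    proof (cases "i < 2")
      case False
      then obtain j where "i = j + 2" by (metis le_add_diff_inverse2 not_less)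
      then show ?thesis by (auto simp: image_iff)
    qed auto
  qed
  moreover have "?S \<subseteq> {..<2 * Suc n}" using S by auto
  moreover have "compat (?g i) (?g (partner i))" if "i < 2 * Suc n" for i
  proof (cases "i < 2")
    case True
    then have "i = 0 \<or> i = 1" by auto
    then show ?thesis using h(1) compat_sym[OF h(1)] by (auto simp: partner_def)
  next
    case False
    then obtain j where "i = Suc (Suc j)" by (metis add_2_eq_Suc le_Suc_ex not_less)
    then show ?thesis using that g by simp
  qed
  ultimately have "config P (Suc n) ?g ?S D (ren shift2 R)"
    using h(2) R wf_rec_ren unfolding config_def by simp
  then show thesis by (rule that)
qed

text \<open>Only the names in focus lose a \<open>Mu\<close>. Their partners may belong to
  \<open>R\<close> and keep theirs, which is harmless because \<open>compat\<close> ignores the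
  number of \<open>Mu\<close>s.\<close>

lemma config_rec:
  assumes "config P n g S (Rec zs B) R"
  shows "config P n (\<lambda>i. if i \<in> S then head_unfold (g i) else g i) S (psub 0 zs B B) R"
proof -
  let ?g = "\<lambda>i. if i \<in> S then head_unfold (g i) else g i"
  from assms have h: "ht (Rec zs B) [] S g" "wf_rec (Rec zs B) []" "ht R [] ({..<2 * n} - S) g"
    and P: "P \<equiv>\<^sub>s nus n (Par (Rec zs B) R)"
    and g: "\<forall>i < 2 * n. compat (g i) (g (partner i))"
    by (simp_all add: config_def)
  have zs: "set zs \<subseteq> S" "\<forall>i \<in> S. i \<notin> set zs \<longrightarrow> g i = None" using h(1) by simp_all
  have "ht (psub 0 zs B B) [] (set zs) ?g"
    by (rule ht_cong[OF conjunct1[OF ht_unfold[OF h(1,2)]]]) (use zs in auto)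
  then have "ht (psub 0 zs B B) [] S ?g" by (rule ht_weaken) (use zs in auto)
  moreover have "ht R [] ({..<2 * n} - S) ?g" by (rule ht_cong[OF h(3)]) auto
  moreover have "wf_rec (psub 0 zs B B) []" using ht_unfold[OF h(1,2)] by blast
  moreover have "P \<equiv>\<^sub>s nus n (Par (psub 0 zs B B) R)"
    using P sc_trans sc_cong_nus sc_cong_par sc_unfold by blast
  moreover have "\<forall>i < 2 * n. compat (?g i) (?g (partner i))"
    using g by (auto simp: compat_unfold)
  ultimately show ?thesis using assms unfolding config_def by blast
qed

section \<open>Redexes\<close>

lemma red_front:
  assumes "P \<equiv>\<^sub>s nus n (Par A R)" "nus_perm n \<sigma>" "0 < n"
    and "Res (Par (ren \<sigma> A) (ren \<sigma> R)) \<longmapsto> Q"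
  shows "\<exists>Q. P \<longmapsto> Q"
proof -
  obtain m where n: "n = Suc m" using assms(3) by (cases n) auto
  have "nus n (Par A R) \<equiv>\<^sub>s nus n (ren \<sigma> (Par A R))"
    using assms(2) unfolding nus_perm_def by blast
  then have "P \<equiv>\<^sub>s nus m (Res (Par (ren \<sigma> A) (ren \<sigma> R)))"
    using assms(1) sc_trans unfolding nus_Res n[symmetric] ren.simps by blast
  moreover have "nus m (Res (Par (ren \<sigma> A) (ren \<sigma> R))) \<longmapsto> nus m Q"
    by (rule red_nus) (rule assms(4))
  ultimately show ?thesis using red_scong sc_refl by blast
qed

text \<open>In the axioms for communication and choice, the restriction contains only the two
  partners, so \<open>R\<close> is first moved out of its scope.\<close>

lemma red_front2:
  assumes "P \<equiv>\<^sub>s nus n (Par A (Par B R))" "nus_perm n \<sigma>" "0 < n"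
    and "\<And>i. i \<in> fn R \<Longrightarrow> 2 \<le> \<sigma> i"
    and "Res (Par (ren \<sigma> A) (ren \<sigma> B)) \<longmapsto> Q"
  shows "\<exists>Q. P \<longmapsto> Q"
proof -
  let ?AB = "Par (ren \<sigma> A) (ren \<sigma> B)"
  have "Res (Par (ren \<sigma> A) (ren \<sigma> (Par B R))) \<equiv>\<^sub>s Res (Par ?AB (ren \<sigma> R))"
    unfolding ren.simps by (intro sc_cong_res sc_par_assoc)
  also have "\<dots> \<equiv>\<^sub>s Par (Res ?AB) (ren (\<lambda>i. \<sigma> i - 2) R)" by (rule res_par_out) (rule assms(4))
  finally have "Res (Par (ren \<sigma> A) (ren \<sigma> (Par B R))) \<longmapsto> Par Q (ren (\<lambda>i. \<sigma> i - 2) R)"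
    by (rule red_scong[OF _ red_par[OF assms(5)] sc_refl])
  then show ?thesis by (rule red_front[OF assms(1-3)])
qed

lemma config_redex:
  assumes "config P n g S A (Par B R)" "x \<in> S" "partner x \<in> {..<2 * n} - S"
    and "subject B = Some (partner x)"
  obtains T \<sigma> where "nus_perm n \<sigma>" "0 < n" "\<sigma> x = 0" "\<sigma> (partner x) = 1"
    "\<And>i. i \<noteq> x \<Longrightarrow> i \<noteq> partner x \<Longrightarrow> 2 \<le> \<sigma> i" "\<And>i. i \<in> fn R \<Longrightarrow> 2 \<le> \<sigma> i"
    "ht A [] S g" "ht B [] T g" "x \<notin> T" "partner x \<notin> S" "P \<equiv>\<^sub>s nus n (Par A (Par B R))"
    "compat (g x) (g (partner x))"
proof -
  have x: "x < 2 * n" using assms(1,2) by (auto simp: config_def)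
  then obtain \<sigma> where \<sigma>: "nus_perm n \<sigma>" "\<sigma> x = 0" "\<sigma> (partner x) = 1"
    by (rule nus_perm_front)
  from assms(1) have "ht (Par B R) [] ({..<2 * n} - S) g" by (simp add: config_def)
  then obtain T U where T: "{..<2 * n} - S = T \<union> U" "T \<inter> U = {}" "ht B [] T g" "ht R [] U g"
    by auto
  have "partner x \<in> T" using ht_subject[OF T(3) assms(4)] by auto
  moreover have "x \<notin> T" "x \<notin> U" using T(1) assms(2) by auto
  \<comment> \<open>By linearity, neither endpoint occurs in the rest.\<close>
  ultimately have "2 \<le> \<sigma> i" if "i \<in> fn R" for i
    using ht_fn[OF T(4)] that T(2) nus_perm_ge2[OF \<sigma>, of i] by auto
  moreover have "0 < n" using x by auto
  ultimately show thesis
    using that[of \<sigma> T] \<sigma> nus_perm_ge2[OF \<sigma>] T(3) \<open>x \<notin> T\<close> assms(1,3) x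
    unfolding config_def by blast
qed

lemma red_send_recv:
  assumes "config P n g S (Send x a b) (Par (Recv (partner x) Q) R)"
  shows "\<exists>Q. P \<longmapsto> Q"
proof -
  let ?B = "Recv (partner x) Q"
  from assms have "ht (Par ?B R) [] ({..<2 * n} - S) g" "x \<in> S" by (auto simp: config_def)
  then have "partner x \<in> {..<2 * n} - S" by auto
  with assms \<open>x \<in> S\<close> obtain T \<sigma> where \<sigma>: "nus_perm n \<sigma>" "0 < n" "\<sigma> x = 0" "\<sigma> (partner x) = 1"
    and ge: "\<And>i. i \<noteq> x \<Longrightarrow> i \<noteq> partner x \<Longrightarrow> 2 \<le> \<sigma> i" and R: "\<And>i. i \<in> fn R \<Longrightarrow> 2 \<le> \<sigma> i"
    and S: "ht (Send x a b) [] S g" "partner x \<notin> S" and T: "ht ?B [] T g" "x \<notin> T"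
    and P: "P \<equiv>\<^sub>s nus n (Par (Send x a b) (Par ?B R))"
    by (rule config_redex) simp_all
  have "2 \<le> \<sigma> a" "2 \<le> \<sigma> b" using S by (auto intro!: ge)
  then have ab: "\<sigma> a = (\<sigma> a - 2) + 2" "\<sigma> b = (\<sigma> b - 2) + 2" by simp_all
  \<comment> \<open>The continuation uses neither endpoint, so its renaming factors through
    \<open>shift2\<close>, as \<open>red_comm\<close> demands.\<close>
  have "ren (up (up \<sigma>)) Q = ren (up (up (shift2 \<circ> (\<lambda>i. \<sigma> i - 2)))) Q"
  proof (rule ren_cong, rule up_up_cong)
    show "\<sigma> j = (shift2 \<circ> (\<lambda>i. \<sigma> i - 2)) j" if "j + 2 \<in> fn Q" for j
    proof -
      have "j \<in> T" "j \<noteq> partner x" using T(1) that by auto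
      then have "2 \<le> \<sigma> j" using T(2) by (intro ge) auto
      then show ?thesis by simp
    qed
  qed
  also have "\<dots> = ren (up (up shift2)) (ren (up (up (\<lambda>i. \<sigma> i - 2))) Q)"
    by (simp only: ren_ren up_comp)
  finally have Q: "ren (up (up \<sigma>)) Q = ren (up (up shift2)) (ren (up (up (\<lambda>i. \<sigma> i - 2))) Q)" .
  have "Res (Par (ren \<sigma> (Send x a b)) (ren \<sigma> ?B)) \<longmapsto>
      ren (case_nat (\<sigma> a - 2) (case_nat (\<sigma> b - 2) id)) (ren (up (up (\<lambda>i. \<sigma> i - 2))) Q)"
    unfolding ren.simps \<sigma>(3,4) Q by (subst (1) ab(1), subst (1) ab(2)) (rule red_comm)
  from red_front2[OF P \<sigma>(1,2) _ this] R show ?thesis by blast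
qed

lemma red_sel_bra:
  assumes "config P n g S (Sel x b j) (Par (Bra (partner x) Qs) R)"
  shows "\<exists>Q. P \<longmapsto> Q"
proof -
  let ?B = "Bra (partner x) Qs"
  from assms have "ht (Par ?B R) [] ({..<2 * n} - S) g" "x \<in> S" by (auto simp: config_def)
  then have "partner x \<in> {..<2 * n} - S" by auto
  with assms \<open>x \<in> S\<close> obtain T \<sigma> where \<sigma>: "nus_perm n \<sigma>" "0 < n" "\<sigma> x = 0" "\<sigma> (partner x) = 1"
    and ge: "\<And>i. i \<noteq> x \<Longrightarrow> i \<noteq> partner x \<Longrightarrow> 2 \<le> \<sigma> i" and R: "\<And>i. i \<in> fn R \<Longrightarrow> 2 \<le> \<sigma> i"
    and S: "ht (Sel x b j) [] S g" "partner x \<notin> S" and T: "ht ?B [] T g" "x \<notin> T"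
    and P: "P \<equiv>\<^sub>s nus n (Par (Sel x b j) (Par ?B R))" and c: "compat (g x) (g (partner x))"
    by (rule config_redex) simp_all
  \<comment> \<open>Compatible heads carry the same label set, which contains \<open>j\<close> on
    the side of the selection.\<close>
  have "j |\<in>| fmdom Qs" using S(1) T(1) c by (auto simp: compat_Some)
  then obtain Q where Q: "fmlookup Qs j = Some Q" by (metis fmdomE)
  have "2 \<le> \<sigma> b" using S by (auto intro!: ge)
  then have b: "\<sigma> b = (\<sigma> b - 2) + 2" by simp
  have "ren (up \<sigma>) Q' = ren (up shift2) (ren (up (\<lambda>i. \<sigma> i - 2)) Q')" if Q': "Q' |\<in>| fmran Qs" for Q'
  proof -
    have "ren (up \<sigma>) Q' = ren (up (shift2 \<circ> (\<lambda>i. \<sigma> i - 2))) Q'"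
    proof (rule ren_cong)
      fix i assume i: "i \<in> fn Q'"
      show "up \<sigma> i = up (shift2 \<circ> (\<lambda>i. \<sigma> i - 2)) i"
      proof (cases i)
        case (Suc k)
        have "k \<in> T" "k \<noteq> partner x" using T(1) Q' i Suc by auto
        then have "2 \<le> \<sigma> k" using T(2) by (intro ge) auto
        then show ?thesis using Suc by simp
      qed simp
    qed
    then show ?thesis by (simp only: ren_ren up_comp)
  qed
  then have Qs: "fmmap (ren (up \<sigma>)) Qs = fmmap (ren (up shift2)) (fmmap (ren (up (\<lambda>i. \<sigma> i - 2))) Qs)"
    unfolding fmap.map_comp by (intro fmap.map_cong) (auto simp: fmran'_alt_def)
  have "fmlookup (fmmap (ren (up (\<lambda>i. \<sigma> i - 2))) Qs) j = Some (ren (up (\<lambda>i. \<sigma> i - 2)) Q)"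
    using Q by simp
  then have "Res (Par (ren \<sigma> (Sel x b j)) (ren \<sigma> ?B)) \<longmapsto>
      ren (case_nat (\<sigma> b - 2) id) (ren (up (\<lambda>i. \<sigma> i - 2)) Q)"
    unfolding ren.simps \<sigma>(3,4) Qs by (subst b) (rule red_choice)
  from red_front2[OF P \<sigma>(1,2) _ this] R show ?thesis by blast
qed

lemma red_config_fwd:
  assumes "config P n g S (Fwd x y) R" "y \<noteq> partner x"
  shows "\<exists>Q. P \<longmapsto> Q"
proof -
  from assms(1) have P: "P \<equiv>\<^sub>s nus n (Par (Fwd x y) R)" and S: "ht (Fwd x y) [] S g" "S \<subseteq> {..<2 * n}"
    and R: "ht R [] ({..<2 * n} - S) g"
    by (simp_all add: config_def)
  have x: "x < 2 * n" using S by auto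
  then obtain \<sigma> where \<sigma>: "nus_perm n \<sigma>" "\<sigma> x = 0" "\<sigma> (partner x) = 1"
    by (rule nus_perm_front)
  have "2 \<le> \<sigma> y" using S(1) assms(2) by (intro nus_perm_ge2[OF \<sigma>]) auto
  then have y: "\<sigma> y = (\<sigma> y - 2) + 2" by simp
  \<comment> \<open>Only \<open>x\<close> is absent from \<open>R\<close>; its partner may occur,
    and becomes the index 0 that \<open>red_fwd\<close> replaces.\<close>
  have "ren \<sigma> R = ren (Suc \<circ> (\<lambda>i. \<sigma> i - 1)) R"
  proof (rule ren_cong)
    fix i assume "i \<in> fn R"
    then have "i \<noteq> x" using ht_fn[OF R] S(1) by auto
    then have "\<sigma> i \<noteq> \<sigma> x" using \<sigma>(1) by (simp add: nus_perm_def inj_eq)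
    then show "\<sigma> i = (Suc \<circ> (\<lambda>i. \<sigma> i - 1)) i" using \<sigma>(2) by simp
  qed
  then have R': "ren \<sigma> R = ren Suc (ren (\<lambda>i. \<sigma> i - 1) R)" by (simp only: ren_ren)
  have "Res (Par (ren \<sigma> (Fwd x y)) (ren \<sigma> R)) \<longmapsto>
      ren (case_nat (\<sigma> y - 2) id) (ren (\<lambda>i. \<sigma> i - 1) R)"
    unfolding ren.simps \<sigma>(2) R' by (subst y) (rule red_fwd)
  moreover have "0 < n" using x by auto
  ultimately show ?thesis using red_front[OF P \<sigma>(1)] by blast
qed

lemma red_partners:
  assumes "config P n g S D (Par C R)" "subject C = Some x" "subject D = Some (partner x)"
  shows "\<exists>Q. P \<longmapsto> Q"
proof -
  let ?U = "{..<2 * n} - S"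
  from assms(1) obtain T V where T: "?U = T \<union> V" "T \<inter> V = {}" "ht C [] T g" "ht R [] V g"
    by (auto simp: config_def)
  from assms(1) have D: "ht D [] S g" "S \<subseteq> {..<2 * n}" "wf_rec D []" "wf_rec C []" "wf_rec R []"
    and g: "\<forall>i < 2 * n. compat (g i) (g (partner i))"
    by (simp_all add: config_def)
  have "S \<union> V = {..<2 * n} - T" "S \<inter> V = {}" "T \<subseteq> {..<2 * n}" using T(1,2) D(2) by auto
  moreover have "ht (Par D R) [] (S \<union> V) g" if "S \<inter> V = {}"
    unfolding ht.simps using that D(1) T(4) by (intro exI[of _ S] exI[of _ V]) auto
  \<comment> \<open>The redex lemmas want the output in focus, and it may be either of the
    two.\<close>
  ultimately have CD: "config P n g T C (Par D R)"
    using T D by (intro config_cong[OF assms(1) sc_par_left_comm]) auto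
  have "x < 2 * n" using ht_subject[OF T(3) assms(2)] T(1) by auto
  then have c: "compat (g x) (g (partner x))" using g by blast
  show ?thesis
  proof (cases C)
    case (Send x' a b)
    then obtain Q where "D = Recv (partner x) Q"
      using T(3) D(1) assms(2,3) c by (cases D) (auto simp: compat_Some)
    then show ?thesis using CD Send assms(2) by (auto intro: red_send_recv)
  next
    case (Sel x' b j)
    then obtain Qs where "D = Bra (partner x) Qs"
      using T(3) D(1) assms(2,3) c by (cases D) (auto simp: compat_Some)
    then show ?thesis using CD Sel assms(2) by (auto intro: red_sel_bra)
  next
    case (Recv x' Q)
    then obtain a b where "D = Send (partner x) a b"
      using T(3) D(1) assms(2,3) c by (cases D) (auto simp: compat_Some)
    then show ?thesis using assms(1,2) Recv red_send_recv[of P n g S "partner x" a b Q R] by simp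
  next
    case (Bra x' Qs)
    then obtain b j where "D = Sel (partner x) b j"
      using T(3) D(1) assms(2,3) c by (cases D) (auto simp: compat_Some)
    then show ?thesis using assms(1,2) Bra red_sel_bra[of P n g S "partner x" b j Qs R] by simp
  qed (use assms(2) in auto)
qed

section \<open>Actions of least priority\<close>

primrec weight :: "proc \<Rightarrow> nat" where
  "weight (Send x a b) = 0"
| "weight (Recv x P) = 0"
| "weight (Sel x b l) = 0"
| "weight (Bra x Ps) = 0"
| "weight (Res P) = Suc (weight P)"
| "weight (Par P Q) = Suc (weight P + weight Q)"
| "weight Inact = 0"
| "weight (Fwd x y) = 0"
| "weight (Rec zs P) = 0"
| "weight (Call X zs) = 0"

text \<open>All configurations of \<open>P\<close> are considered, so the least priority accounts
  for actions that appear only after loops are unfolded.\<close>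

definition offers :: "proc \<Rightarrow> nat \<Rightarrow> bool" where
  "offers P p \<longleftrightarrow>
     (\<exists>n g S D R x k c. config P n g S D R \<and> subject D = Some x \<and> g x = Some (k, p, c))"

text \<open>If \<open>C\<close> acts on \<open>x\<close> with the least priority, then \<open>D\<close>, which holds the other endpoint,
  must act on it as well: in a payload or under a prefix, the endpoint would have a higher priority
  than the subject. Unfolding the loops around the endpoint ends because it decreases the number
  of leading \<open>Mu\<close>s of the type of the endpoint, which is a connective after finitely many steps.\<close>

lemma red_least_priority:
  assumes least: "\<And>q. offers P q \<Longrightarrow> p \<le> q"
  shows "config P n g S D (Par C R) \<Longrightarrow> subject C = Some x \<Longrightarrow> x \<notin> S \<Longrightarrow>
    partner x \<in> S \<Longrightarrow> g (partner x) = Some (k, p, c) \<Longrightarrow> \<exists>Q. P \<longmapsto> Q"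
\<comment> \<open>Unfolding a loop decreases \<open>c\<close>; entering a restriction or a parallel
  composition keeps \<open>c\<close> and decreases the weight.\<close>
proof (induction "(c, weight D)" arbitrary: n g S D C R x c rule: wf_induct_rule[OF wf_lex_prod[OF wf_less wf_less]])
  case 1
  note IH = "1.hyps" and conf = "1.prems"(1) and x = "1.prems"(2-)
  from conf have D: "ht D [] S g" "wf_rec D []" by (simp_all add: config_def)
  show ?case
  proof (cases "subject D")
    case (Some y)
    from D(1) Some obtain l q where y: "y \<in> S" "g y = Some (l, q, 0)"
      "\<And>i. i \<in> S \<Longrightarrow> i \<noteq> y \<Longrightarrow> above q (g i)" by (rule ht_subject) blast
    have "offers P q" using conf Some y(2) unfolding offers_def by blast
    then have "p \<le> q" by (rule least)
    \<comment> \<open>Any other name held by \<open>D\<close> has priority above \<open>q\<close>,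
      hence above \<open>p\<close>, whereas \<open>partner x\<close> has priority
      \<open>p\<close>.\<close>
    then have "y = partner x" using y(3)[OF x(3)] x(4) by auto
    with Some show ?thesis by (intro red_partners[OF conf x(1)]) simp
  next
    case None
    show ?thesis
    proof (cases D)
      case (Par D1 D2)
      with conf obtain A where A: "A \<subseteq> S" "config P n g A D1 (Par D2 (Par C R))"
        "config P n g (S - A) D2 (Par D1 (Par C R))" by (auto elim: config_par_left)
      show ?thesis
      proof (cases "partner x \<in> A")
        case True
        show ?thesis
          by (rule IH[OF _ config_left_comm[OF A(2)] x(1) _ True x(4)]) (use Par A(1) x(2) in auto)
      next
        case False
        show ?thesis
          by (rule IH[OF _ config_left_comm[OF A(3)] x(1) _ _ x(4)])
            (use Par A(1) x(2,3) False in auto)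
      qed
    next
      case (Res D')
      with conf obtain h h' where
        "config P (Suc n) (case_nat h (case_nat h' g)) ({0, 1} \<union> shift2 ` S) D' (ren shift2 (Par C R))"
        by (auto elim: config_res)
      then have "config P (Suc n) (case_nat h (case_nat h' g)) ({0, 1} \<union> shift2 ` S) D'
          (Par (ren shift2 C) (ren shift2 R))"
        by (simp only: ren.simps)
      then show ?thesis
        by (rule IH[rotated, where x = "x + 2" and c = c]) (use Res x in \<open>auto simp: subject_ren\<close>)
    next
      case (Rec zs B)
      \<comment> \<open>The endpoint has a connective, whereas names held by the loop but not listed
        in \<open>zs\<close> are headless. So it is listed, and its type starts with
        \<open>Mu\<close>.\<close>
      have "unfoldable (g (partner x))"
        using D(1) Rec x(3,4) by (cases "partner x \<in> set zs") auto
      then have "0 < c" using x(4) by simp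
      then show ?thesis
        by (intro IH[rotated, OF config_rec[OF conf[unfolded Rec]] x(1), where c = "c - 1"])
          (use x in auto)
    next
      case Inact
      with D x show ?thesis by simp
    next
      case (Fwd u v)
      \<comment> \<open>The forwarder holds the only names in \<open>S\<close> with a connective,
        hence \<open>partner x\<close>. It does not hold \<open>x\<close>, so it does not join two
        partners.\<close>
      with D x have "partner x = u \<or> partner x = v" "x \<noteq> u" "x \<noteq> v" "u \<noteq> v" by auto
      then have "v \<noteq> partner u" by (metis partner_partner)
      then show ?thesis using red_config_fwd conf Fwd by blast
    next
      case (Call X zs)
      with D show ?thesis by simp
    qed (use None in auto)
  qed
qed

lemma offers_red:
  assumes "offers P q"
  shows "\<exists>Q. P \<longmapsto> Q"
proof -
  define p where "p = (LEAST q. offers P q)"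
  have "offers P p" unfolding p_def using assms by (rule LeastI)
  have least: "p \<le> q" if "offers P q" for q unfolding p_def using that by (rule Least_le)
  from \<open>offers P p\<close> obtain n g S C R x k c where
    conf: "config P n g S C R" and x: "subject C = Some x" "g x = Some (k, p, c)"
    unfolding offers_def by blast
  from conf have C: "ht C [] S g" "S \<subseteq> {..<2 * n}"
    and g: "\<forall>i < 2 * n. compat (g i) (g (partner i))" by (simp_all add: config_def)
  from C(1) x(1) obtain l q where S: "x \<in> S" "g x = Some (l, q, 0)"
    "\<And>i. i \<in> S \<Longrightarrow> i \<noteq> x \<Longrightarrow> above q (g i)" by (rule ht_subject) blast
  have less: "x < 2 * n" using C(2) S(1) by auto
  then obtain c' where y: "g (partner x) = Some (dual_kind k, p, c')"
    using g x(2) by (metis compat_Some)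
  \<comment> \<open>Dual endpoints have equal priority, but every other name of the process acting
    on \<open>x\<close> has a higher one.\<close>
  have "partner x \<notin> S" using S(3)[of "partner x"] y S(2) x(2) by auto
  have "config P n g ({..<2 * n} - S) R (Par C Inact)"
    by (intro config_par_inact config_swap conf)
  then show ?thesis
    by (rule red_least_priority[rotated, where x = x])
      (use least x(1) S(1) \<open>partner x \<notin> S\<close> partner_less[OF less] y in auto)
qed


section \<open>Exposing an action\<close>

text \<open>Bounding the number \<open>m\<close> of loops around an action makes unfolding terminate, since an
  unfolding need not decrease the size of a process.\<close>

primrec action_at :: "proc \<Rightarrow> nat \<Rightarrow> bool" where
  "action_at (Send x a b) m = True"
| "action_at (Recv x P) m = True"
| "action_at (Sel x b l) m = True"
| "action_at (Bra x Ps) m = True"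
| "action_at (Res P) m = action_at P m"
| "action_at (Par P Q) m = (action_at P m \<or> action_at Q m)"
| "action_at Inact m = False"
| "action_at (Fwd x y) m = False"
| "action_at (Rec zs P) m = (0 < m \<and> action_at P (m - 1))"
| "action_at (Call X zs) m = False"

lemma exposes_action_at: "exposes_action P \<Longrightarrow> \<exists>m. action_at P m"
proof (induction P)
  case (Par P Q)
  then show ?case unfolding action_at.simps exposes_action.simps by blast
next
  case (Rec zs P)
  then obtain m where "action_at P m" by auto
  then show ?case by (intro exI[of _ "Suc m"]) simp
qed auto

lemma action_at_psub: "action_at P m \<Longrightarrow> action_at (psub k zs B P) m"
  by (induction P arbitrary: k zs B m) auto

lemma action_at_offers:
  "action_at D m \<Longrightarrow> config P n g S D R \<Longrightarrow> \<exists>q. offers P q"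
proof (induction m arbitrary: n g S D R rule: less_induct)
  case (less m)
  have prefix: "\<exists>q. offers P q" if c: "config P n g S D R" and "subject D \<noteq> None" for D n g S R
  proof -
    obtain x where x: "subject D = Some x" using \<open>subject D \<noteq> None\<close> by blast
    have "ht D [] S g" using c by (simp add: config_def)
    then obtain k q where "g x = Some (k, q, 0)" using x by (rule ht_subject)
    then show ?thesis using x c unfolding offers_def by blast
  qed
  show ?case using less.prems
  proof (induction D arbitrary: n g S R)
    case (Res D)
    then obtain n g S R where "config P n g S D R" by (auto elim: config_res)
    then show ?case using Res by auto
  next
    case (Par D1 D2)
    then obtain A where A: "config P n g A D1 (Par D2 R)" "config P n g (S - A) D2 (Par D1 R)"
      by (auto elim: config_par_left)
    from Par.prems(1) have "action_at D1 m \<or> action_at D2 m" by simp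
    then show ?case using Par.IH A by blast
  next
    case (Rec zs B)
    \<comment> \<open>The action in the body is no call, so it survives the substitution and has one
      loop fewer around it.\<close>
    then have "m - 1 < m" "action_at (psub 0 zs B B) (m - 1)" by (auto intro: action_at_psub)
    then show ?case using less.IH config_rec[OF Rec.prems(2)] by blast
  qed (auto intro: prefix)
qed


section \<open>Processes without actions\<close>

primrec inert :: "proc \<Rightarrow> bool" where
  "inert (Send x a b) = False"
| "inert (Recv x P) = False"
| "inert (Sel x b l) = False"
| "inert (Bra x Ps) = False"
| "inert (Res P) = inert P"
| "inert (Par P Q) = (inert P \<and> inert Q)"
| "inert Inact = True"
| "inert (Fwd x y) = True"
| "inert (Rec zs P) = inert P"
| "inert (Call X zs) = False"

primrec fwds :: "proc \<Rightarrow> nat" where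
  "fwds (Send x a b) = 0"
| "fwds (Recv x P) = 0"
| "fwds (Sel x b l) = 0"
| "fwds (Bra x Ps) = 0"
| "fwds (Res P) = fwds P"
| "fwds (Par P Q) = fwds P + fwds Q"
| "fwds Inact = 0"
| "fwds (Fwd x y) = 1"
| "fwds (Rec zs P) = fwds P"
| "fwds (Call X zs) = 0"

text \<open>By contractivity, a loop without exposed actions has no exposed call to itself. Calls to
  outer variables are excluded by the last premise, and \<open>wf_rec\<close> leaves no
  others.\<close>

lemma inertI:
  "contractive P \<Longrightarrow> \<not> exposes_action P \<Longrightarrow> wf_rec P ar \<Longrightarrow>
   (\<And>k. k < length ar \<Longrightarrow> \<not> exposes_call k P) \<Longrightarrow> inert P"
proof (induction P arbitrary: ar)
  case (Rec zs P)
  have "inert P"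
  proof (rule Rec.IH)
    show "\<not> exposes_call k P" if "k < length (length zs # ar)" for k
      using that Rec.prems by (cases k) auto
  qed (use Rec.prems in auto)
  then show ?case by simp
qed auto

lemma inert_ren: "inert P \<Longrightarrow> inert (ren f P)"
  by (induction P arbitrary: f) auto

lemma fwds_ren: "fwds (ren f P) = fwds P"
  by (induction P arbitrary: f) auto

lemma inert_psub: "inert P \<Longrightarrow> psub k zs B P = P"
  by (induction P arbitrary: k zs B) auto

lemma inert_rec: "inert B \<Longrightarrow> Rec zs B \<equiv>\<^sub>s B"
  using sc_unfold[of zs B] by (simp add: inert_psub)

lemma inert_no_fwds: "inert P \<Longrightarrow> fwds P = 0 \<Longrightarrow> P \<equiv>\<^sub>s Inact"
proof (induction P)
  case (Res P)
  then show ?case by (auto intro: sc_trans[OF sc_cong_res sc_res_inact])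
next
  case (Par P Q)
  then have "P \<equiv>\<^sub>s Inact" "Q \<equiv>\<^sub>s Inact" by auto
  then have "Par P Q \<equiv>\<^sub>s Par P Inact" by (intro sc_cong_par_right)
  also have "\<dots> \<equiv>\<^sub>s P" by (rule sc_par_inact)
  also note \<open>P \<equiv>\<^sub>s Inact\<close>
  finally show ?case .
next
  case (Rec zs P)
  then show ?case by (auto intro: sc_trans[OF inert_rec])
qed (auto intro: sc_refl)

text \<open>Forwarders do not constrain the heads of their two names, so without exposed actions and
  calls all heads can be forgotten. The names of a configuration can then be renumbered without
  tracking heads.\<close>

lemma ht_inert: "ht P \<Omega> S g \<Longrightarrow> inert P \<Longrightarrow> ht P \<Omega>' S (\<lambda>_. None)"
proof (induction P arbitrary: \<Omega> \<Omega>' S g)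
  case (Res P)
  then obtain h h' where "ht P \<Omega> ({0, 1} \<union> shift2 ` S) (case_nat h (case_nat h' g))" "inert P"
    by auto
  from Res.IH[OF this] have "ht P \<Omega>' ({0, 1} \<union> shift2 ` S) (case_nat None (case_nat None (\<lambda>_. None)))"
    by (rule ht_cong) (auto simp: image_iff)
  then show ?case unfolding ht.simps using compat_None by blast
next
  case (Par P Q)
  then obtain S1 S2 where "S = S1 \<union> S2" "S1 \<inter> S2 = {}" "ht P \<Omega> S1 g" "ht Q \<Omega> S2 g"
    "inert P" "inert Q" by auto
  with Par.IH(1)[OF this(3,5)] Par.IH(2)[OF this(4,6)] show ?case by auto
next
  case (Rec zs P)
  then show ?case by (auto simp: comp_def)
qed auto

lemma config_find_fwd:
  "config P n g S D R \<Longrightarrow> inert D \<Longrightarrow> inert R \<Longrightarrow> 0 < fwds D \<Longrightarrow>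
   \<exists>n g S x y R'. config P n g S (Fwd x y) R' \<and> inert R' \<and> Suc (fwds R') = fwds D + fwds R"
proof (induction D arbitrary: n g S R)
  case (Res D)
  then obtain n' g' S' where c: "config P n' g' S' D (ren shift2 R)" by (auto elim: config_res)
  have "inert D" "inert (ren shift2 R)" "0 < fwds D" using Res.prems inert_ren by auto
  from Res.IH[OF c this] show ?case by (simp add: fwds_ren)
next
  case (Par D1 D2)
  then obtain A where A: "config P n g A D1 (Par D2 R)" "config P n g (S - A) D2 (Par D1 R)"
    by (auto elim: config_par_left)
  have inert: "inert D1" "inert D2" "inert (Par D2 R)" "inert (Par D1 R)" using Par.prems by auto
  show ?case
  proof (cases "0 < fwds D1")
    case True
    from Par.IH(1)[OF A(1) inert(1,3) True] show ?thesis by (simp add: add.assoc)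
  next
    case False
    then have "0 < fwds D2" using Par.prems by simp
    from Par.IH(2)[OF A(2) inert(2,4) this] show ?thesis by (simp add: ac_simps)
  qed
next
  case (Rec zs B)
  have "psub 0 zs B B = B" using Rec.prems by (simp add: inert_psub)
  with config_rec[OF Rec.prems(1)] Rec show ?case by fastforce
next
  case (Fwd x y)
  then show ?case by (intro exI[of _ n] exI[of _ g] exI[of _ S] exI[of _ x] exI[of _ y] exI[of _ R]) simp
qed auto

text \<open>The channel is moved to the innermost position, the rest leaves its scope, and
  \<open>Res (Fwd 0 1)\<close> vanishes. The remaining names drop by 2.\<close>

lemma config_remove_fwd:
  assumes "config P n g S (Fwd x (partner x)) R" "inert R"
  obtains m R' where "config P m (\<lambda>_. None) {..<2 * m} R' Inact" "inert R'" "fwds R' = fwds R"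
proof -
  from assms(1) have P: "P \<equiv>\<^sub>s nus n (Par (Fwd x (partner x)) R)"
    and S: "x \<in> S" "partner x \<in> S" "S \<subseteq> {..<2 * n}"
    and R: "ht R [] ({..<2 * n} - S) g" "wf_rec R []"
    by (simp_all add: config_def)
  let ?U = "{..<2 * n} - S"
  have x: "x < 2 * n" using S by auto
  then obtain \<sigma> where \<sigma>: "nus_perm n \<sigma>" "\<sigma> x = 0" "\<sigma> (partner x) = 1"
    by (rule nus_perm_front)
  obtain m where n: "n = Suc m" using x by (cases n) auto
  have ge: "2 \<le> \<sigma> i" if "i \<in> ?U" for i using that S by (intro nus_perm_ge2[OF \<sigma>]) auto
  let ?R = "ren (\<lambda>i. \<sigma> i - 2) R"
  have "P \<equiv>\<^sub>s nus n (ren \<sigma> (Par (Fwd x (partner x)) R))"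
    using P \<sigma>(1) sc_trans unfolding nus_perm_def by blast
  then have "P \<equiv>\<^sub>s nus m (Res (Par (Fwd 0 1) (ren \<sigma> R)))"
    by (simp only: ren.simps \<sigma> n nus_Res)
  also have "Res (Par (Fwd 0 1) (ren \<sigma> R)) \<equiv>\<^sub>s Par (Res (Fwd 0 1)) ?R"
    by (rule res_par_out) (use ge ht_fn[OF R(1)] in blast)
  then have "nus m (Res (Par (Fwd 0 1) (ren \<sigma> R))) \<equiv>\<^sub>s nus m (Par (Res (Fwd 0 1)) ?R)"
    by (rule sc_cong_nus)
  also have "nus m (Par (Res (Fwd 0 1)) ?R) \<equiv>\<^sub>s nus m (Par ?R Inact)"
    by (rule sc_cong_nus) (meson sc_cong_par sc_par_comm sc_res_fwd sc_trans)
  finally have "P \<equiv>\<^sub>s nus m (Par ?R Inact)" .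
  moreover have "ht R [] ?U (\<lambda>_. None)" using R(1) assms(2) by (rule ht_inert)
  then have "ht ?R [] ((\<lambda>i. \<sigma> i - 2) ` ?U) (\<lambda>_. None)"
  proof (rule ht_ren)
    show "inj_on (\<lambda>i. \<sigma> i - 2) ?U"
    proof (rule inj_onI)
      fix i j assume "i \<in> ?U" "j \<in> ?U" "\<sigma> i - 2 = \<sigma> j - 2"
      with ge[of i] ge[of j] have "\<sigma> i = \<sigma> j" by simp
      then show "i = j" using \<sigma>(1) by (simp add: nus_perm_def inj_eq)
    qed
  qed simp
  then have "ht ?R [] {..<2 * m} (\<lambda>_. None)"
  proof (rule ht_weaken)
    show "(\<lambda>i. \<sigma> i - 2) ` ?U \<subseteq> {..<2 * m}"
    proof
      fix j assume "j \<in> (\<lambda>i. \<sigma> i - 2) ` ?U"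
      then obtain i where i: "i \<in> ?U" "j = \<sigma> i - 2" by blast
      then have "\<sigma> i < 2 * n" using \<sigma>(1) by (auto simp: nus_perm_def)
      then show "j \<in> {..<2 * m}" using i(2) ge[OF i(1)] n by simp
    qed
  qed simp
  ultimately have "config P m (\<lambda>_. None) {..<2 * m} ?R Inact"
    using wf_rec_ren[OF R(2)] by (simp add: config_def)
  then show thesis by (rule that) (use assms(2) in \<open>simp_all add: inert_ren fwds_ren\<close>)
qed

lemma inert_progress:
  "config P n g S D Inact \<Longrightarrow> inert D \<Longrightarrow> P \<equiv>\<^sub>s Inact \<or> (\<exists>Q. P \<longmapsto> Q)"
proof (induction "fwds D" arbitrary: n g S D)
  case 0
  have "Par D Inact \<equiv>\<^sub>s Inact"
    using sc_trans[OF sc_par_inact inert_no_fwds] 0 by auto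
  then have "nus n (Par D Inact) \<equiv>\<^sub>s Inact" using sc_trans[OF sc_cong_nus nus_inact] by blast
  then show ?case using 0 sc_trans unfolding config_def by blast
next
  case (Suc N)
  \<comment> \<open>Some forwarder can be brought into focus. Either it reduces, or it joins two
    partners and is removed, which decreases the count.\<close>
  then obtain n g S x y R where R: "config P n g S (Fwd x y) R" "inert R" "fwds R = N"
    using config_find_fwd[of P n g S D Inact] by auto
  show ?case
  proof (cases "y = partner x")
    case True
    with R obtain m R' where "config P m (\<lambda>_. None) {..<2 * m} R' Inact" "inert R'" "N = fwds R'"
      by (metis config_remove_fwd)
    with Suc.hyps(1) show ?thesis by blast
  next
    case False
    with R(1) show ?thesis using red_config_fwd by blast
  qed
qed

theorem mainTheorem3:
  fixes P :: proc
  assumes "contractive P"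
    and "[] \<turnstile> P \<triangleright> Map.empty"
  shows "P \<equiv>\<^sub>s Inact \<or> (\<exists>Q. P \<longmapsto> Q)"
proof -
  have "ht P [] {} (head_ctx Map.empty)" "wf_rec P []"
    using typed_ht[OF assms(2)] by simp_all
  \<comment> \<open>The process is closed, so the initial configuration has no restrictions pulled
    out and no names.\<close>
  then have conf: "config P 0 (head_ctx Map.empty) {} P Inact"
    by (simp add: config_def sc_sym[OF sc_par_inact])
  show ?thesis
  proof (cases "exposes_action P")
    case True
    then show ?thesis
      using exposes_action_at action_at_offers[OF _ conf] offers_red by blast
  next
    case False
    then have "inert P" using assms(1) \<open>wf_rec P []\<close> by (intro inertI) auto
    with conf show ?thesis by (rule inert_progress)
  qed
qed

end
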